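(* Let $Q_1,\dots,Q_K$ be fractional hitting-sets for $\mathcal B_1,\dots,\mathcal B_K$ respectively and let $\lambda\in[0,\infty)^{\mathcal X}$. If $S(\mathcal B_k,Q_k,\lambda)<1$ for all $k\in[K]$, and for all $i\in[n]$ we have $$\lambda_i\ \ge\ 1+\sum_{k=1}^K\frac{G_i(Q_k,\lambda)}{1-S(\mathcal B_k,Q_k,\lambda)},$$ then the Partial Resampling Algorithm PRA-multi, run with the probability vector $p_{i,j}=\lambda_{i,j}/\lambda_i$, terminates with probability one, and the expected number of resamplings is at most $\sum_{i=1}^n(\lambda_i-1)$.
   Context: Variables $X_1,\dots,X_n$; variable $X_i$ takes values in a finite set $F_i$. An element is a pair $(i,j)$ with $i\in[n]$, $j\in F_i$; $\mathcal X$ is the set of all elements. $\mathcal A\subseteq2^{\mathcal X}$ is the family of atomic sets: all non-empty sets $\{(i_1,j_1),\dots,(i_r,j_r)\}$ with $i_1,\dots,i_r$ distinct and $j_\ell\in F_{i_\ell}$. $Y\in\mathcal A$ holds (is true) on a configuration $(X_1,\dots,X_n)$ if $X_i=j$ for all $(i,j)\in Y$. For $\lambda\in[0,\infty)^{\mathcal X}$, $\lambda^Y=\prod_{x\in Y}\lambda_x$. There are $K$ (complex) bad-events $\mathcal B_1,\dots,\mathcal B_K\subseteq\mathcal A$, not necessarily disjoint. A function $Q:\mathcal A\to[0,1]$ is a fractional hitting-set for $\mathcal B\subseteq\mathcal A$ if $\sum_{Y\subseteq B,\,Y\neq\emptyset}Q(Y)\ge1$ for every $B\in\mathcal B$. PRA-multi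 with probability vector $p$ ($\sum_jp_{i,j}=1$): draw $X_1,\dots,X_n$ independently with $\Pr(X_i=j)=p_{i,j}$. While some $B\in\mathcal B_1\cup\dots\cup\mathcal B_K$ is true: arbitrarily select $k\in[K]$ and a true $B\in\mathcal B_k$; select exactly one subset $Y\subseteq B$, a given $Y$ with probability $Q_k(Y)/\sum_{Z\subseteq B}Q_k(Z)$; resample every variable involved in $Y$ independently according to $p$. Return $X$. Each iteration of the loop is one resampling. (For $K=1$ this is the PRA.) For $Y,Y'\in\mathcal A$: $Y\sim Y'$ iff there are $i,j,j'$ with $(i,j)\in Y$, $(i,j')\in Y'$; $Y\sim i$ iff $(i,j)\in Y$ for some $j$. With respect to $\mathcal B\subseteq\mathcal A$: $Y\bowtie Y'$ iff $Y\not\sim Y'$ and there is $B\in\mathcal B$ with $Y,Y'\subseteq B$. For $\mathcal B\subseteq\mathcal A$, $Q$ a fractional hitting-set for $\mathcal B$, and $\lambda\in[0,\infty)^{\mathcal X}$: $$S(\mathcal B,Q,\lambda)=\max_{Y\in\mathcal A:\,Q(Y)>0}\ \sum_{Z\in\mathcal A:\,Z\bowtie Y}Q(Z)\lambda^Z,\qquad \lambda_i=\sum_{j\in F_i}\lambda_{i,j},\qquad G_i(Q,\lambda)=\sum_{Y\in\mathcal A:\,Y\sim i}Q(Y)\lambda^Y,$$ where $\bowtie$ is taken with respect to $\mathcal B$ (and a maximum over the empty set is $0$). *)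

theory Defs
  imports "HOL-Probability.Probability"
begin

text \<open>
  Variables are indexed by \<open>{1..n}\<close>, variable \<open>i\<close> has domain \<open>F i\<close>, and an element is a pair
  \<open>(i, j)\<close>. Functions given on elements, atomic sets or variable indices are total in HOL; the
  definitions below only use their values on the intended domains.
\<close>

type_synonym 'v event = "(nat \<times> 'v) set"
type_synonym 'v config = "nat \<Rightarrow> 'v"

definition elements :: "nat \<Rightarrow> (nat \<Rightarrow> 'v set) \<Rightarrow> (nat \<times> 'v) set" where
  "elements n F = (SIGMA i:{1..n}. F i)"

definition atomic :: "nat \<Rightarrow> (nat \<Rightarrow> 'v set) \<Rightarrow> 'v event set" where
  "atomic n F = {Y. Y \<noteq> {} \<and> Y \<subseteq> elements n F \<and> inj_on fst Y}"

definition holds :: "'v event \<Rightarrow> 'v config \<Rightarrow> bool" where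
  "holds Y X \<longleftrightarrow> (\<forall>(i, j)\<in>Y. X i = j)"

definition fractional_hitting_set ::
    "nat \<Rightarrow> (nat \<Rightarrow> 'v set) \<Rightarrow> 'v event set \<Rightarrow> ('v event \<Rightarrow> real) \<Rightarrow> bool" where
  "fractional_hitting_set n F Bs Q \<longleftrightarrow>
     (\<forall>Y\<in>atomic n F. 0 \<le> Q Y \<and> Q Y \<le> 1) \<and>
     (\<forall>B\<in>Bs. (\<Sum>Y | Y \<subseteq> B \<and> Y \<noteq> {}. Q Y) \<ge> 1)"

subsection \<open>The quantities in the convergence criterion\<close>

definition monomial :: "(nat \<times> 'v \<Rightarrow> real) \<Rightarrow> 'v event \<Rightarrow> real" where
  "monomial lam Y = (\<Prod>x\<in>Y. lam x)"

definition related :: "'v event \<Rightarrow> 'v event \<Rightarrow> bool" where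
  "related Y Y' \<longleftrightarrow> (\<exists>i j j'. (i, j) \<in> Y \<and> (i, j') \<in> Y')"

definition involves :: "'v event \<Rightarrow> nat \<Rightarrow> bool" where
  "involves Y i \<longleftrightarrow> (\<exists>j. (i, j) \<in> Y)"

definition bowtie :: "'v event set \<Rightarrow> 'v event \<Rightarrow> 'v event \<Rightarrow> bool" where
  "bowtie Bs Y Y' \<longleftrightarrow> \<not> related Y Y' \<and> (\<exists>B\<in>Bs. Y \<subseteq> B \<and> Y' \<subseteq> B)"

definition S ::
    "nat \<Rightarrow> (nat \<Rightarrow> 'v set) \<Rightarrow> 'v event set \<Rightarrow> ('v event \<Rightarrow> real) \<Rightarrow> (nat \<times> 'v \<Rightarrow> real) \<Rightarrow> real" where
  "S n F Bs Q lam =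
     (let D = {Y \<in> atomic n F. Q Y > 0}
      in if D = {} then 0
         else Max ((\<lambda>Y. \<Sum>Z | Z \<in> atomic n F \<and> bowtie Bs Z Y. Q Z * monomial lam Z) ` D))"

definition var_sum :: "(nat \<Rightarrow> 'v set) \<Rightarrow> (nat \<times> 'v \<Rightarrow> real) \<Rightarrow> nat \<Rightarrow> real" where
  "var_sum F lam i = (\<Sum>j\<in>F i. lam (i, j))"

definition G ::
    "nat \<Rightarrow> (nat \<Rightarrow> 'v set) \<Rightarrow> nat \<Rightarrow> ('v event \<Rightarrow> real) \<Rightarrow> (nat \<times> 'v \<Rightarrow> real) \<Rightarrow> real" where
  "G n F i Q lam = (\<Sum>Y | Y \<in> atomic n F \<and> involves Y i. Q Y * monomial lam Y)"

subsection \<open>The Partial Resampling Algorithm\<close>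

definition var_pmf :: "(nat \<Rightarrow> 'v set) \<Rightarrow> (nat \<Rightarrow> 'v \<Rightarrow> real) \<Rightarrow> nat \<Rightarrow> 'v pmf" where
  "var_pmf F p i = embed_pmf (\<lambda>j. if j \<in> F i then p i j else 0)"

definition subset_pmf :: "('v event \<Rightarrow> real) \<Rightarrow> 'v event \<Rightarrow> 'v event pmf" where
  "subset_pmf Q B = embed_pmf (\<lambda>Y. if Y \<subseteq> B \<and> Y \<noteq> {}
                                   then Q Y / (\<Sum>Z | Z \<subseteq> B \<and> Z \<noteq> {}. Q Z) else 0)"

text \<open>
  A state \<open>(X, h)\<close> of the algorithm consists of the current configuration and a log of the
  iterations performed so far, most recent first. The entry \<open>(X', k, B, Y)\<close> records that, in
  configuration \<open>X'\<close>, the bad-event \<open>B\<close> of the \<open>k\<close>-th family was selected and \<open>Y \<subseteq> B\<close> was resampled.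
\<close>

type_synonym 'v state = "'v config \<times> ('v config \<times> nat \<times> 'v event \<times> 'v event) list"

text \<open>
  The arbitrary choice of \<open>k\<close> and \<open>B\<close> is made by a selection rule, which may depend on the whole
  past of the execution and may itself be randomized (deterministic rules are those of the form
  \<open>return_pmf \<circ> f\<close>).
\<close>

type_synonym 'v rule = "'v state \<Rightarrow> (nat \<times> 'v event) pmf"

definition true_bad_events ::
    "nat \<Rightarrow> (nat \<Rightarrow> 'v event set) \<Rightarrow> 'v config \<Rightarrow> (nat \<times> 'v event) set" where
  "true_bad_events K Bs X = {(k, B). k \<in> {1..K} \<and> B \<in> Bs k \<and> holds B X}"

definition valid_rule :: "nat \<Rightarrow> (nat \<Rightarrow> 'v event set) \<Rightarrow> 'v rule \<Rightarrow> bool" where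
  "valid_rule K Bs sel \<longleftrightarrow>
     (\<forall>X h. true_bad_events K Bs X \<noteq> {} \<longrightarrow> set_pmf (sel (X, h)) \<subseteq> true_bad_events K Bs X)"

definition pra_step ::
    "(nat \<Rightarrow> 'v set) \<Rightarrow> (nat \<Rightarrow> 'v event \<Rightarrow> real) \<Rightarrow> (nat \<Rightarrow> 'v \<Rightarrow> real) \<Rightarrow> 'v rule
     \<Rightarrow> 'v state \<Rightarrow> 'v state pmf" where
  "pra_step F Q p sel = (\<lambda>(X, h).
     bind_pmf (sel (X, h)) (\<lambda>(k, B).
     bind_pmf (subset_pmf (Q k) B) (\<lambda>Y.
     bind_pmf (Pi_pmf (fst ` Y) undefined (var_pmf F p)) (\<lambda>X'.
     return_pmf (override_on X X' (fst ` Y), (X, k, B, Y) # h)))))"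

partial_function (spmf) prob_while :: "('s \<Rightarrow> bool) \<Rightarrow> ('s \<Rightarrow> 's pmf) \<Rightarrow> 's \<Rightarrow> 's spmf" where
  "prob_while b c s =
     (if b s then bind_spmf (spmf_of_pmf (c s)) (\<lambda>s'. prob_while b c s') else return_spmf s)"

text \<open>
  The result is a subprobability distribution on final states, that is, a distribution on an option
  type in which \<open>None\<close> carries the probability of non-termination.
\<close>

definition pra_multi ::
    "nat \<Rightarrow> (nat \<Rightarrow> 'v set) \<Rightarrow> nat \<Rightarrow> (nat \<Rightarrow> 'v event set) \<Rightarrow> (nat \<Rightarrow> 'v event \<Rightarrow> real)
     \<Rightarrow> (nat \<Rightarrow> 'v \<Rightarrow> real) \<Rightarrow> 'v rule \<Rightarrow> 'v state spmf" where
  "pra_multi n F K Bs Q p sel =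
     bind_spmf (spmf_of_pmf (Pi_pmf {1..n} undefined (var_pmf F p))) (\<lambda>X.
     prob_while (\<lambda>(X, h). true_bad_events K Bs X \<noteq> {}) (pra_step F Q p sel) (X, []))"

text \<open>A non-terminating run counts as infinitely many resamplings.\<close>

definition expected_resamplings :: "'v state spmf \<Rightarrow> ennreal" where
  "expected_resamplings R =
     (\<integral>\<^sup>+ r. (case r of None \<Rightarrow> \<infinity> | Some (X, h) \<Rightarrow> of_nat (length h)) \<partial>measure_pmf R)"

subsection \<open>The distributions above are the intended ones\<close>

lemma finite_atomic:
  assumes "\<And>i. i \<in> {1..n} \<Longrightarrow> finite (F i)"
  shows "finite (atomic n F)"
proof -
  have "finite (elements n F)" using assms by (auto simp: elements_def)
  then show ?thesis by (rule finite_subset[rotated, OF finite_Pow_iff[THEN iffD2]])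
      (auto simp: atomic_def)
qed

lemma pmf_embed_finite:
  fixes f :: "'a \<Rightarrow> real"
  assumes "finite A" "\<And>x. x \<in> A \<Longrightarrow> 0 \<le> f x" "sum f A = 1"
  shows "pmf (embed_pmf (\<lambda>x. if x \<in> A then f x else 0)) x = (if x \<in> A then f x else 0)"
proof (rule pmf_embed_pmf)
  have "(\<integral>\<^sup>+ x. ennreal (if x \<in> A then f x else 0) \<partial>count_space UNIV)
      = (\<Sum>x\<in>A. ennreal (if x \<in> A then f x else 0))"
    by (rule nn_integral_count_space'[OF assms(1)]) auto
  also have "\<dots> = ennreal (sum f A)"
    using assms(2) by (simp add: sum_ennreal)
  finally show "(\<integral>\<^sup>+ x. ennreal (if x \<in> A then f x else 0) \<partial>count_space UNIV) = 1"
    using assms(3) by simp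
qed (use assms(2) in auto)

lemma pmf_var_pmf:
  assumes "finite (F i)" "\<And>j. j \<in> F i \<Longrightarrow> 0 \<le> p i j" "(\<Sum>j\<in>F i. p i j) = 1"
  shows "pmf (var_pmf F p i) j = (if j \<in> F i then p i j else 0)"
  unfolding var_pmf_def by (rule pmf_embed_finite) (use assms in auto)

lemma pmf_subset_pmf:
  assumes fin: "\<And>i. i \<in> {1..n} \<Longrightarrow> finite (F i)"
    and Q: "fractional_hitting_set n F Bs Q" and Bs: "Bs \<subseteq> atomic n F" and B: "B \<in> Bs"
  shows "pmf (subset_pmf Q B) Y =
    (if Y \<subseteq> B \<and> Y \<noteq> {} then Q Y / (\<Sum>Z | Z \<subseteq> B \<and> Z \<noteq> {}. Q Z) else 0)"
proof -
  let ?A = "{Z. Z \<subseteq> B \<and> Z \<noteq> {}}"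
  have sub: "?A \<subseteq> atomic n F"
    using Bs B by (auto simp: atomic_def intro: inj_on_subset)
  have A: "finite ?A" using finite_subset[OF sub finite_atomic[OF fin]] .
  have nonneg: "0 \<le> Q Z" if "Z \<in> ?A" for Z
    using Q sub that by (auto simp: fractional_hitting_set_def)
  have ge: "sum Q ?A \<ge> 1" using Q B by (auto simp: fractional_hitting_set_def)
  have "pmf (embed_pmf (\<lambda>Z. if Z \<in> ?A then Q Z / sum Q ?A else 0)) Y
      = (if Y \<in> ?A then Q Y / sum Q ?A else 0)"
    by (rule pmf_embed_finite[OF A]) (use nonneg ge in \<open>auto simp: sum_divide_distrib[symmetric]\<close>)
  then show ?thesis by (simp add: subset_pmf_def)
qed

end

theory Submission imports Defs begin

text \<open>
  A configuration is rated by a potential that every iteration lowers by at least one in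
  expectation, whatever bad-event the selection rule picks, and whose expected value at the start is
  at most \<open>\<Sum>i. (\<lambda>\<^sub>i - 1)\<close>. Comparing the potential with the number of iterations performed
  (\<open>prob_while_expected_length\<close>) gives both termination and the bound.

  The potential is the total weight of the non-empty witness trees. A vertex of such a tree is a
  resampled set \<open>Y\<close> together with the index \<open>k\<close> of its family, and the tree describes, read from the
  leaves to the root, which resamplings lie ahead. Its weight is the product of the values
  \<open>Q\<^sub>k(Y)\<close> and of one factor per element of each \<open>Y\<close>: an element whose variable occurs nowhere deeper in
  the tree must already be true and is compared with the current configuration, every other one
  refers to a value that is still to be drawn and costs its probability.

  Performing an iteration corresponds to attaching the resampled set \<open>Y \<subseteq> B\<close> to a tree as a new leaf,
  below the deepest eligible vertex. Eligible are the vertices that share a variable with \<open>Y\<close>, as in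
  the analysis of Moser and Tardos. This alone does not suffice for partial resampling: if the tree
  announces \<open>Y\<^sub>0 \<subseteq> B\<close>, but another, disjoint subset of \<open>B\<close> is resampled, then \<open>B\<close> can become true
  again and \<open>Y\<^sub>0\<close> gets a second chance, so that its weight is not bounded by \<open>Q\<^sub>k(Y\<^sub>0)\<close>. Therefore a
  childless vertex of the same family that is contained in \<open>B\<close> is eligible as well. With this rule,
  for fixed \<open>k\<close> and \<open>B\<close>, a tree arises by attachment from at most one pair of a set and a tree
  (\<open>attach_inject\<close>), and a tree that arises in this way admits the attachment of all subsets of \<open>B\<close>
  (\<open>attach_imp_attachable\<close>). Hence a tree of the larger height is charged either for the pair it
  arises from, at a rate of at most one because the values of \<open>Q\<^sub>k\<close> below \<open>B\<close> sum to at least one, or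
  for those outcomes of the random choice of \<open>Y\<close> that leave it alone, which have total probability at
  most one (\<open>weight_drift\<close>).

  On average over the initial configuration every element costs its probability, and the sum over all
  trees can be evaluated recursively from the root as for a branching process. The total weight of the
  trees with root \<open>(k, Y)\<close> is at most \<open>Q\<^sub>k(Y) \<lambda>\<^sup>Y / (1 - S\<^sub>k)\<close>. Indeed, a vertex has for each of its
  variables \<open>i\<close> at most one child that shares \<open>i\<close>, which contributes a factor \<open>\<lambda>\<^sub>i\<close> by hypothesis and
  turns \<open>p\<^sub>i\<^sub>j\<close> into \<open>\<lambda>\<^sub>i\<^sub>j\<close>, and at most one child in the relation \<open>\<bowtie>\<close>, since the second clause of
  eligibility needs a childless vertex. The latter contributes
  \<open>1 + S\<^sub>k / (1 - S\<^sub>k) = 1 / (1 - S\<^sub>k)\<close> (\<open>majorant_branching\<close>).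
\<close>

section \<open>Sums over labelled trees\<close>

text \<open>
  A tree is the partial map from positions to vertex labels, where a position is the path of slots that
  leads from the root to the vertex. Adding or removing a leaf is then a function update, and two
  trees are equal as soon as they agree at all positions.
\<close>

type_synonym ('s, 'l) tree = "'s list \<Rightarrow> 'l option"

definition plant :: "'s set \<Rightarrow> 'l \<Rightarrow> ('s \<Rightarrow> ('s, 'l) tree) \<Rightarrow> ('s, 'l) tree" where
  "plant Sl l f q = (case q of [] \<Rightarrow> Some l | s # r \<Rightarrow> if s \<in> Sl then f s r else None)"

text \<open>
  The trees of height at most \<open>m\<close> whose root label lies in \<open>R\<close> and in which a vertex labelled \<open>l\<close> may
  carry, in each slot \<open>s\<close>, one child with a label from \<open>C l s\<close>. The recursion over the subtrees of the
  root is the one along which weights are summed.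
\<close>

primrec trees :: "'s set \<Rightarrow> ('l \<Rightarrow> 's \<Rightarrow> 'l set) \<Rightarrow> 'l set \<Rightarrow> nat \<Rightarrow> ('s, 'l) tree set" where
  "trees Sl C R 0 = {Map.empty}"
| "trees Sl C R (Suc m) = insert Map.empty
     (\<Union>l\<in>R. plant Sl l ` (\<Pi>\<^sub>E s\<in>Sl. trees Sl C (C l s) m))"

definition tree_weight :: "('l \<Rightarrow> real) \<Rightarrow> ('s, 'l) tree \<Rightarrow> real" where
  "tree_weight w \<tau> = (\<Prod>q\<in>dom \<tau>. w (the (\<tau> q)))"

lemma plant_simps:
  "plant Sl l f [] = Some l" "s \<in> Sl \<Longrightarrow> plant Sl l f (s # r) = f s r"
  by (simp_all add: plant_def)

lemma dom_plant: "dom (plant Sl l f) = insert [] (\<Union>s\<in>Sl. (#) s ` dom (f s))"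
proof (rule set_eqI)
  fix q show "q \<in> dom (plant Sl l f) \<longleftrightarrow> q \<in> insert [] (\<Union>s\<in>Sl. (#) s ` dom (f s))"
    by (cases q) (auto simp: plant_def image_iff dom_def)
qed

lemma finite_dom_trees:
  assumes "finite Sl" "\<tau> \<in> trees Sl C R m"
  shows "finite (dom \<tau>)"
  using assms(2)
proof (induction m arbitrary: R \<tau>)
  case (Suc m)
  show ?case
  proof (cases "\<tau> = Map.empty")
    case False
    then obtain l f where "\<tau> = plant Sl l f" "\<And>s. s \<in> Sl \<Longrightarrow> f s \<in> trees Sl C (C l s) m"
      using Suc.prems by (auto simp: PiE_iff)
    then have "finite (dom (f s))" if "s \<in> Sl" for s
      using Suc.IH that by blast
    then show ?thesis using assms(1) \<open>\<tau> = plant Sl l f\<close> by (simp add: dom_plant)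
  qed simp
qed auto

lemma finite_trees:
  assumes "finite Sl" "finite R" "\<And>l s. finite (C l s)"
  shows "finite (trees Sl C R m)"
  using assms(2)
proof (induction m arbitrary: R)
  case (Suc m)
  then show ?case using assms by (auto intro!: finite_PiE)
qed simp

lemma inj_on_plant:
  "inj_on (\<lambda>(l, f). plant Sl l f) (SIGMA l:R. \<Pi>\<^sub>E s\<in>Sl. T l s)"
proof (rule inj_onI, clarify)
  fix l f l' f'
  assume f: "f \<in> (\<Pi>\<^sub>E s\<in>Sl. T l s)" "f' \<in> (\<Pi>\<^sub>E s\<in>Sl. T l' s)"
    and eq: "plant Sl l f = plant Sl l' f'"
  have "f s = f' s" for s
  proof (cases "s \<in> Sl")
    case True
    then have "f s r = f' s r" for r
      using fun_cong[OF eq, of "s # r"] by (simp add: plant_def)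
    then show ?thesis by blast
  next
    case False
    then show ?thesis using PiE_arb[OF f(1)] PiE_arb[OF f(2)] by metis
  qed
  moreover have "l = l'" using fun_cong[OF eq, of "[]"] by (simp add: plant_def)
  ultimately show "l = l' \<and> f = f'" by blast
qed

lemma tree_weight_plant:
  assumes "finite Sl" "\<And>s. s \<in> Sl \<Longrightarrow> finite (dom (f s))"
  shows "tree_weight w (plant Sl l f) = w l * (\<Prod>s\<in>Sl. tree_weight w (f s))"
proof -
  let ?c = "\<lambda>q. w (the (plant Sl l f q))"
  have "tree_weight w (plant Sl l f) = ?c [] * (\<Prod>q\<in>(\<Union>s\<in>Sl. (#) s ` dom (f s)). ?c q)"
    unfolding tree_weight_def dom_plant using assms by (intro prod.insert) auto
  also have "(\<Prod>q\<in>(\<Union>s\<in>Sl. (#) s ` dom (f s)). ?c q) = (\<Prod>s\<in>Sl. \<Prod>q\<in>(#) s ` dom (f s). ?c q)"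
    using assms by (intro prod.UNION_disjoint) auto
  also have "\<dots> = (\<Prod>s\<in>Sl. tree_weight w (f s))"
    unfolding tree_weight_def by (rule prod.cong) (simp_all add: prod.reindex plant_simps)
  finally show ?thesis by (simp only: plant_simps option.sel)
qed

text \<open>
  The local description of the same trees, in terms of single vertices and their parents.
\<close>

lemma trees_memI:
  assumes "\<And>q. q \<in> dom \<tau> \<Longrightarrow> length q < m"
    and "\<And>l. \<tau> [] = Some l \<Longrightarrow> l \<in> R"
    and "\<And>q s l. \<tau> (q @ [s]) = Some l \<Longrightarrow> s \<in> Sl \<and> (\<exists>l'. \<tau> q = Some l' \<and> l \<in> C l' s)"
  shows "\<tau> \<in> trees Sl C R m"
  using assms
proof (induction m arbitrary: R \<tau>)
  case 0
  then have "dom \<tau> = {}" by blast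
  then show ?case by simp
next
  case (Suc m)
  note child = Suc.prems(3)
  have prefix: "\<tau> q \<noteq> None" if "\<tau> (q @ r) \<noteq> None" for q r
    using that
  proof (induction r rule: rev_induct)
    case (snoc s r)
    then show ?case using child[of "q @ r" s] by auto
  qed simp
  show ?case
  proof (cases "\<tau> []")
    case None
    then have "\<tau> = Map.empty" using prefix[of "[]"] by fastforce
    then show ?thesis by simp
  next
    case (Some l)
    define f where "f = restrict (\<lambda>s r. \<tau> (s # r)) Sl"
    have "f s \<in> trees Sl C (C l s) m" if s: "s \<in> Sl" for s
    proof (rule Suc.IH)
      show "length q < m" if "q \<in> dom (f s)" for q
        using Suc.prems(1)[of "s # q"] that s by (auto simp: f_def)
      show "l' \<in> C l s" if "f s [] = Some l'" for l'
        using child[of "[]" s l'] that s Some by (auto simp: f_def)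
      show "s' \<in> Sl \<and> (\<exists>l''. f s q = Some l'' \<and> l' \<in> C l'' s')" if "f s (q @ [s']) = Some l'" for q s' l'
        using child[of "s # q" s' l'] that s by (auto simp: f_def)
    qed
    then have "f \<in> (\<Pi>\<^sub>E s\<in>Sl. trees Sl C (C l s) m)" by (auto simp: f_def)
    moreover have "plant Sl l f q = \<tau> q" for q
    proof (cases q)
      case (Cons s r)
      have "\<tau> (s # r) = None \<or> s \<in> Sl"
        using prefix[of "[s]" r] child[of "[]" s] by (cases "\<tau> (s # r)") auto
      then show ?thesis using Cons by (cases "s \<in> Sl") (auto simp: plant_def f_def)
    qed (simp add: plant_def Some)
    then have "\<tau> = plant Sl l f" by auto
    ultimately show ?thesis using Suc.prems(2)[OF Some] by auto
  qed
qed

lemma trees_label_in: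
  assumes "\<tau> \<in> trees Sl C R m" "R \<subseteq> L" "\<And>l s. C l s \<subseteq> L" "\<tau> q = Some l"
  shows "l \<in> L"
  using assms(1,2,4)
proof (induction m arbitrary: R \<tau> q)
  case (Suc m)
  then obtain l0 f where \<tau>: "l0 \<in> R" "\<tau> = plant Sl l0 f" and f: "f \<in> (\<Pi>\<^sub>E s\<in>Sl. trees Sl C (C l0 s) m)"
    by auto
  show ?case
  proof (cases q)
    case Nil
    then show ?thesis using \<tau> Suc.prems by (auto simp: plant_simps)
  next
    case (Cons s r)
    then have s: "s \<in> Sl" and "f s r = Some l"
      using Suc.prems(3) \<tau> by (auto simp: plant_def split: if_splits)
    with f show ?thesis using Suc.IH[of "f s" "C l0 s" r] assms(3) by auto
  qed
qed simp

text \<open>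
  The bound on the total progeny of a multitype branching process: summing over the root label and,
  independently in every slot, over the subtree there, a function \<open>\<mu>\<close> that satisfies the branching
  inequality dominates the total weight of the trees with a given root label at every height. The
  summand \<open>1\<close> is the empty tree; non-negativity is carried along because products of such sums have
  to be compared.
\<close>

lemma sum_tree_weight_le:
  fixes w \<mu> :: "'l \<Rightarrow> real"
  assumes fin: "finite Sl" "\<And>l s. finite (C l s)"
    and nonneg: "\<And>l. l \<in> L \<Longrightarrow> 0 \<le> w l \<and> 0 \<le> \<mu> l" and closed: "\<And>l s. C l s \<subseteq> L"
    and branch: "\<And>l. l \<in> L \<Longrightarrow> w l * (\<Prod>s\<in>Sl. 1 + (\<Sum>l'\<in>C l s. \<mu> l')) \<le> \<mu> l"
    and R: "finite R" "R \<subseteq> L"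
  shows "0 \<le> (\<Sum>\<tau>\<in>trees Sl C R m. tree_weight w \<tau>) \<and>
    (\<Sum>\<tau>\<in>trees Sl C R m. tree_weight w \<tau>) \<le> 1 + (\<Sum>l\<in>R. \<mu> l)"
  using R
proof (induction m arbitrary: R)
  case 0
  then show ?case using nonneg by (auto simp: tree_weight_def intro!: sum_nonneg)
next
  case (Suc m)
  let ?W = "\<lambda>l s. \<Sum>\<tau>\<in>trees Sl C (C l s) m. tree_weight w \<tau>"
  let ?P = "\<lambda>l. \<Pi>\<^sub>E s\<in>Sl. trees Sl C (C l s) m"
  have IH: "0 \<le> ?W l s \<and> ?W l s \<le> 1 + (\<Sum>l'\<in>C l s. \<mu> l')" for l s
    using fin closed by (intro Suc.IH) auto
  have split: "(\<Sum>\<tau>\<in>trees Sl C R (Suc m). tree_weight w \<tau>) = 1 + (\<Sum>l\<in>R. w l * (\<Prod>s\<in>Sl. ?W l s))"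
  proof -
    let ?I = "(\<lambda>(l, f). plant Sl l f) ` (SIGMA l:R. ?P l)"
    have I: "trees Sl C R (Suc m) = insert Map.empty ?I" by auto
    have "Map.empty \<notin> ?I" by (auto simp: plant_def fun_eq_iff split: list.splits)
    moreover have "finite ?I" using fin Suc.prems finite_trees[OF fin(1) _ fin(2)]
      by (intro finite_imageI finite_SigmaI finite_PiE) auto
    ultimately have "(\<Sum>\<tau>\<in>trees Sl C R (Suc m). tree_weight w \<tau>) = 1 + (\<Sum>\<tau>\<in>?I. tree_weight w \<tau>)"
      unfolding I by (subst sum.insert) (auto simp: tree_weight_def)
    also have "(\<Sum>\<tau>\<in>?I. tree_weight w \<tau>) = (\<Sum>(l, f)\<in>(SIGMA l:R. ?P l). tree_weight w (plant Sl l f))"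
      by (subst sum.reindex[OF inj_on_plant]) (simp add: case_prod_unfold)
    also have "\<dots> = (\<Sum>l\<in>R. \<Sum>f\<in>?P l. tree_weight w (plant Sl l f))"
      using fin Suc.prems finite_trees[OF fin(1) _ fin(2)] by (subst sum.Sigma) (auto intro!: finite_PiE)
    also have "\<dots> = (\<Sum>l\<in>R. \<Sum>f\<in>?P l. w l * (\<Prod>s\<in>Sl. tree_weight w (f s)))"
      using fin(1) by (intro sum.cong refl tree_weight_plant) (auto intro!: finite_dom_trees dest: PiE_mem)
    also have "\<dots> = (\<Sum>l\<in>R. w l * (\<Prod>s\<in>Sl. ?W l s))"
      using fin finite_trees[OF fin(1) _ fin(2)]
      by (intro sum.cong refl, subst prod_sum_PiE) (auto simp: sum_distrib_left)
    finally show ?thesis .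
  qed
  have "w l * (\<Prod>s\<in>Sl. ?W l s) \<le> \<mu> l" if "l \<in> R" for l
  proof -
    have "w l * (\<Prod>s\<in>Sl. ?W l s) \<le> w l * (\<Prod>s\<in>Sl. 1 + (\<Sum>l'\<in>C l s. \<mu> l'))"
      using IH that Suc.prems nonneg by (intro mult_left_mono prod_mono) auto
    also have "\<dots> \<le> \<mu> l" using branch that Suc.prems by auto
    finally show ?thesis .
  qed
  moreover have "0 \<le> (\<Sum>l\<in>R. w l * (\<Prod>s\<in>Sl. ?W l s))"
  proof (rule sum_nonneg)
    fix l assume "l \<in> R"
    then show "0 \<le> w l * (\<Prod>s\<in>Sl. ?W l s)"
      using Suc.prems nonneg IH by (intro mult_nonneg_nonneg prod_nonneg ballI) blast+
  qed
  ultimately show ?case unfolding split by (auto intro: sum_mono)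
qed

section \<open>Witness trees\<close>

type_synonym 'v label = "nat \<times> 'v event"
type_synonym 'v wtree = "(nat option, 'v label) tree"

lemma related_iff: "related Y Z \<longleftrightarrow> (\<exists>i. involves Y i \<and> involves Z i)"
  by (auto simp: related_def involves_def)

lemma related_sym: "related Y Z \<longleftrightarrow> related Z Y"
  by (auto simp: related_iff)

lemma involves_iff: "involves Y i \<longleftrightarrow> i \<in> fst ` Y"
  by (force simp: involves_def)

lemma atomic_subset: "B \<in> atomic n F \<Longrightarrow> Y \<subseteq> B \<Longrightarrow> Y \<noteq> {} \<Longrightarrow> Y \<in> atomic n F"
  by (auto simp: atomic_def intro: inj_on_subset)

text \<open>
  The second clause catches a bad-event \<open>B\<close> of family \<open>k\<close> in which another subset than the recorded
  \<open>Z\<close> is resampled. Restricting it to childless vertices ensures that a vertex receives at most one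
  child for this reason.
\<close>

definition eligible :: "'v wtree \<Rightarrow> nat \<Rightarrow> 'v event \<Rightarrow> 'v event \<Rightarrow> nat option list \<Rightarrow> bool" where
  "eligible \<tau> k B Y q \<longleftrightarrow> (\<exists>l Z. \<tau> q = Some (l, Z) \<and>
     (related Y Z \<or> l = k \<and> Z \<subseteq> B \<and> (\<forall>s. \<tau> (q @ [s]) = None)))"

definition attachable :: "nat \<Rightarrow> 'v event \<Rightarrow> 'v event \<Rightarrow> 'v wtree \<Rightarrow> bool" where
  "attachable k B Y \<tau> \<longleftrightarrow> \<tau> = Map.empty \<or> (\<exists>q. eligible \<tau> k B Y q)"

text \<open>
  A child that shares variables with its parent occupies the slot of the least shared one; the slot
  \<open>None\<close> is for children in the relation \<open>bowtie\<close> with their parent.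
\<close>

definition slot :: "'v event \<Rightarrow> 'v event \<Rightarrow> nat option" where
  "slot Y Z = (if related Y Z then Some (LEAST i. involves Y i \<and> involves Z i) else None)"

definition parent :: "nat \<Rightarrow> 'v event \<Rightarrow> 'v event \<Rightarrow> 'v wtree \<Rightarrow> nat option list" where
  "parent k B Y \<tau> = arg_max length (eligible \<tau> k B Y)"

definition position :: "nat \<Rightarrow> 'v event \<Rightarrow> 'v event \<Rightarrow> 'v wtree \<Rightarrow> nat option list" where
  "position k B Y \<tau> = (if \<tau> = Map.empty then []
     else parent k B Y \<tau> @ [slot Y (snd (the (\<tau> (parent k B Y \<tau>))))])"

definition attach :: "nat \<Rightarrow> 'v event \<Rightarrow> 'v event \<Rightarrow> 'v wtree \<Rightarrow> 'v wtree" where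
  "attach k B Y \<tau> = \<tau>(position k B Y \<tau> \<mapsto> (k, Y))"

locale bad_events =
  fixes n K :: nat and F :: "nat \<Rightarrow> 'v set" and Bs :: "nat \<Rightarrow> 'v event set"
  assumes finite_F: "\<And>i. i \<in> {1..n} \<Longrightarrow> finite (F i)"
    and Bs_atomic: "\<And>k. k \<in> {1..K} \<Longrightarrow> Bs k \<subseteq> atomic n F"
begin

definition labels :: "'v label set" where
  "labels = {1..K} \<times> atomic n F"

definition slots :: "nat option set" where
  "slots = insert None (Some ` {1..n})"

definition child_labels :: "'v label \<Rightarrow> nat option \<Rightarrow> 'v label set" where
  "child_labels l s = {l' \<in> labels. case s of
      None \<Rightarrow> fst l' = fst l \<and> bowtie (Bs (fst l)) (snd l') (snd l)
    | Some i \<Rightarrow> involves (snd l) i \<and> involves (snd l') i}"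

text \<open>
  Witness trees of height at most \<open>m\<close>. The last condition makes the vertices that involve a given
  variable linearly ordered by their depth, which is the reverse order of time.
\<close>

definition wtrees :: "nat \<Rightarrow> 'v wtree set" where
  "wtrees m = {\<tau>. (\<forall>q\<in>dom \<tau>. length q < m) \<and> ran \<tau> \<subseteq> labels \<and>
     (\<forall>q s l. \<tau> (q @ [s]) = Some l \<longrightarrow> (\<exists>l'. \<tau> q = Some l' \<and> l \<in> child_labels l' s)) \<and>
     (\<forall>q q' l l'. \<tau> q = Some l \<longrightarrow> \<tau> q' = Some l' \<longrightarrow> length q = length q' \<longrightarrow> q \<noteq> q' \<longrightarrow>
        \<not> related (snd l) (snd l'))}"

lemma finite_labels: "finite labels"
  using finite_atomic[of n F, OF finite_F] by (auto simp: labels_def)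

lemma finite_child_labels: "finite (child_labels l s)"
  using finite_labels by (auto simp: child_labels_def)

lemma finite_slots: "finite slots"
  by (simp add: slots_def)

lemma child_labels_slot:
  assumes "l' \<in> child_labels l s"
  shows "s \<in> slots"
  using assms by (fastforce simp: child_labels_def slots_def labels_def atomic_def elements_def
      involves_def split: option.splits)

lemma wtreesD:
  assumes "\<tau> \<in> wtrees m"
  shows "\<tau> q = Some l \<Longrightarrow> length q < m"
    and "\<tau> q = Some l \<Longrightarrow> l \<in> labels"
    and "\<tau> (q @ [s]) = Some l \<Longrightarrow> \<exists>l'. \<tau> q = Some l' \<and> l \<in> child_labels l' s"
    and "\<tau> q = Some l \<Longrightarrow> \<tau> q' = Some l' \<Longrightarrow> length q = length q' \<Longrightarrow> q \<noteq> q'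
      \<Longrightarrow> \<not> related (snd l) (snd l')"
  using assms unfolding wtrees_def ran_def dom_def by blast+

lemma wtrees_subset_trees: "wtrees m \<subseteq> trees slots child_labels labels m"
proof
  fix \<tau> assume \<tau>: "\<tau> \<in> wtrees m"
  show "\<tau> \<in> trees slots child_labels labels m"
  proof (rule trees_memI)
    show "length q < m" if "q \<in> dom \<tau>" for q
      using that wtreesD(1)[OF \<tau>] by blast
    show "l \<in> labels" if "\<tau> [] = Some l" for l
      using that by (rule wtreesD(2)[OF \<tau>])
    show "s \<in> slots \<and> (\<exists>l'. \<tau> q = Some l' \<and> l \<in> child_labels l' s)"
      if "\<tau> (q @ [s]) = Some l" for q s l
      using wtreesD(3)[OF \<tau> that] child_labels_slot by blast
  qed
qed

lemma finite_wtrees: "finite (wtrees m)"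
  by (rule finite_subset[OF wtrees_subset_trees])
    (intro finite_trees finite_slots finite_labels finite_child_labels)

lemma finite_dom_wtrees: "\<tau> \<in> wtrees m \<Longrightarrow> finite (dom \<tau>)"
  using wtrees_subset_trees finite_dom_trees[OF finite_slots] by blast

lemma wtrees_mono: "wtrees m \<subseteq> wtrees (Suc m)"
  unfolding wtrees_def by (blast intro: less_SucI)

lemma wtrees_prefix:
  assumes "\<tau> \<in> wtrees m" "\<tau> (q @ r) \<noteq> None"
  shows "\<tau> q \<noteq> None"
  using assms(2)
proof (induction r rule: rev_induct)
  case (snoc s r)
  then obtain l where "\<tau> ((q @ r) @ [s]) = Some l" by auto
  then have "\<tau> (q @ r) \<noteq> None" using wtreesD(3)[OF assms(1)] by blast
  with snoc.IH show ?case .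
qed simp

lemma wtrees_leaf:
  assumes "\<tau> \<in> wtrees m" "\<tau> q = None"
  shows "\<tau> (q @ [s]) = None"
  using wtrees_prefix[OF assms(1), of q "[s]"] assms(2) by blast

lemma parent_eligible:
  assumes "\<tau> \<in> wtrees m" "attachable k B Y \<tau>" "\<tau> \<noteq> Map.empty"
  shows "eligible \<tau> k B Y (parent k B Y \<tau>)"
    and "eligible \<tau> k B Y q \<Longrightarrow> length q \<le> length (parent k B Y \<tau>)"
proof -
  obtain q0 where q0: "eligible \<tau> k B Y q0"
    using assms by (auto simp: attachable_def)
  have "\<forall>q. eligible \<tau> k B Y q \<longrightarrow> length q < m"
    using wtreesD(1)[OF assms(1)] by (auto simp: eligible_def)
  then show "eligible \<tau> k B Y (parent k B Y \<tau>)"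
    and "eligible \<tau> k B Y q \<Longrightarrow> length q \<le> length (parent k B Y \<tau>)"
    using arg_max_nat_lemma[where P = "eligible \<tau> k B Y", OF q0] unfolding parent_def by blast+
qed

lemma position_deeper:
  assumes "\<tau> \<in> wtrees m" "attachable k B Y \<tau>" "eligible \<tau> k B Y q"
  shows "length q < length (position k B Y \<tau>)"
proof -
  have ne: "\<tau> \<noteq> Map.empty" using assms(3) by (auto simp: eligible_def)
  with parent_eligible(2)[OF assms(1,2) ne assms(3)] show ?thesis
    by (simp add: position_def)
qed

lemma position_related_deeper:
  assumes "\<tau> \<in> wtrees m" "attachable k B Y \<tau>" "\<tau> q = Some l" "related Y (snd l)"
  shows "length q < length (position k B Y \<tau>)"
  using assms by (cases l) (auto simp: eligible_def intro!: position_deeper)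

lemma slot_child_label:
  assumes "B \<in> Bs k" "k \<in> {1..K}" "Y \<subseteq> B" "Y \<noteq> {}"
    and "related Y Z \<or> l = k \<and> Z \<subseteq> B"
  shows "(k, Y) \<in> child_labels (l, Z) (slot Y Z)"
proof -
  have "(k, Y) \<in> labels"
    using assms Bs_atomic[of k] atomic_subset[of B n F Y] by (auto simp: labels_def)
  moreover have "involves Y (LEAST i. involves Y i \<and> involves Z i) \<and>
      involves Z (LEAST i. involves Y i \<and> involves Z i)" if "related Y Z"
    using that unfolding related_iff by (rule LeastI_ex)
  ultimately show ?thesis
    using assms by (auto simp: child_labels_def slot_def bowtie_def)
qed

text \<open>
  An occupant of the slot in question would share a variable with \<open>Y\<close> and hence be a deeper eligible
  vertex; the slot \<open>None\<close> is only used below a childless vertex.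
\<close>

lemma position_free:
  assumes "\<tau> \<in> wtrees m" "attachable k B Y \<tau>"
  shows "\<tau> (position k B Y \<tau>) = None"
proof (cases "\<tau> = Map.empty")
  case False
  let ?q = "parent k B Y \<tau>"
  obtain l Z where q: "\<tau> ?q = Some (l, Z)"
    and rel: "related Y Z \<or> l = k \<and> Z \<subseteq> B \<and> (\<forall>s. \<tau> (?q @ [s]) = None)"
    using parent_eligible(1)[OF assms False] by (auto simp: eligible_def)
  have pos: "position k B Y \<tau> = ?q @ [slot Y Z]" using False q by (simp add: position_def)
  show ?thesis
  proof (rule ccontr)
    assume "\<tau> (position k B Y \<tau>) \<noteq> None"
    then obtain l' where l': "\<tau> (?q @ [slot Y Z]) = Some l'" unfolding pos by blast
    with rel have "related Y Z" by auto
    then obtain i where s: "slot Y Z = Some i" and i: "involves Y i"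
      using LeastI_ex[of "\<lambda>i. involves Y i \<and> involves Z i"] by (auto simp: slot_def related_iff)
    obtain l'' where "l' \<in> child_labels l'' (slot Y Z)"
      using wtreesD(3)[OF assms(1) l'] by blast
    then have "related Y (snd l')" using s i by (auto simp: child_labels_def related_iff)
    then show False using position_related_deeper[OF assms l'] pos by simp
  qed
qed simp

lemma attach_wtrees:
  assumes "\<tau> \<in> wtrees m" "attachable k B Y \<tau>"
    and B: "B \<in> Bs k" "k \<in> {1..K}" "Y \<subseteq> B" "Y \<noteq> {}"
  shows "attach k B Y \<tau> \<in> wtrees (Suc m)"
proof -
  let ?v = "position k B Y \<tau>" and ?\<tau> = "attach k B Y \<tau>"
  have free: "\<tau> ?v = None" using position_free assms by blast
  have label: "(k, Y) \<in> labels"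
    using assms Bs_atomic[of k] atomic_subset[of B n F Y] by (auto simp: labels_def)
  have len: "length ?v < Suc m"
  proof (cases "\<tau> = Map.empty")
    case False
    then show ?thesis using parent_eligible(1)[OF assms(1,2)] wtreesD(1)[OF assms(1)]
      by (auto simp: position_def eligible_def)
  qed (simp add: position_def)
  have child: "\<exists>l'. ?\<tau> q = Some l' \<and> l \<in> child_labels l' s" if ql: "?\<tau> (q @ [s]) = Some l" for q s l
  proof (cases "q @ [s] = ?v")
    case True
    then have ne: "\<tau> \<noteq> Map.empty" by (auto simp: position_def)
    obtain l' Z where q: "\<tau> (parent k B Y \<tau>) = Some (l', Z)"
      and rel: "related Y Z \<or> l' = k \<and> Z \<subseteq> B"
      using parent_eligible(1)[OF assms(1,2) ne] by (auto simp: eligible_def)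
    have "q = parent k B Y \<tau>" "s = slot Y Z" using True ne q by (auto simp: position_def)
    moreover have "l = (k, Y)" using ql True by (simp add: attach_def)
    moreover have "q \<noteq> ?v" using True by auto
    ultimately show ?thesis
      using q slot_child_label[OF B rel] by (simp add: attach_def)
  next
    case False
    then have "\<tau> (q @ [s]) = Some l" using ql by (simp add: attach_def)
    then obtain l' where "\<tau> q = Some l'" "l \<in> child_labels l' s"
      using wtreesD(3)[OF assms(1)] by blast
    moreover have "q \<noteq> ?v" using free \<open>\<tau> q = Some l'\<close> by auto
    ultimately show ?thesis by (simp add: attach_def)
  qed
  have new: "\<not> related Y (snd l)" if "\<tau> q = Some l" "length q = length ?v" for q l
    using position_related_deeper[OF assms(1,2) that(1)] that(2) by auto
  have sep: "\<not> related (snd l) (snd l')"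
    if "?\<tau> q = Some l" "?\<tau> q' = Some l'" "length q = length q'" "q \<noteq> q'" for q q' l l'
  proof -
    consider "q = ?v" | "q' = ?v" | "q \<noteq> ?v" "q' \<noteq> ?v" by blast
    then show ?thesis
    proof cases
      case 1
      then show ?thesis using that new[of q' l'] by (auto simp: attach_def)
    next
      case 2
      then show ?thesis using that new[of q l] related_sym[of Y "snd l"] by (auto simp: attach_def)
    next
      case 3
      then have "\<tau> q = Some l" "\<tau> q' = Some l'" using that by (auto simp: attach_def)
      with that show ?thesis using wtreesD(4)[OF assms(1)] by blast
    qed
  qed
  have "\<forall>q\<in>dom ?\<tau>. length q < Suc m"
    using len wtreesD(1)[OF assms(1)] by (auto simp: attach_def less_SucI)
  moreover have "ran ?\<tau> \<subseteq> labels"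
    using label wtreesD(2)[OF assms(1)] by (auto simp: attach_def ran_def)
  ultimately show ?thesis
    unfolding wtrees_def using child sep by blast
qed

lemma attach_leaf:
  assumes "\<tau> \<in> wtrees m" "attachable k B Y \<tau>"
  shows "attach k B Y \<tau> (position k B Y \<tau> @ [s]) = None"
  using wtrees_leaf[OF assms(1) position_free[OF assms]] by (simp add: attach_def)

text \<open>
  The leaf that has just been attached is childless and contained in \<open>B\<close>, so it is eligible whatever
  is resampled next on account of \<open>B\<close>.
\<close>

lemma attach_imp_attachable:
  assumes "\<tau> \<in> wtrees m" "attachable k B Y \<tau>" "Y \<subseteq> B"
  shows "attachable k B Y' (attach k B Y \<tau>)"
proof -
  have "eligible (attach k B Y \<tau>) k B Y' (position k B Y \<tau>)"
    using attach_leaf[OF assms(1,2)] assms(3) by (simp add: eligible_def attach_def)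
  then show ?thesis unfolding attachable_def by blast
qed

lemma attach_nonempty: "attach k B Y \<tau> \<noteq> Map.empty"
  by (auto simp: attach_def fun_eq_iff)

text \<open>
  If a tree arises in two ways with different new leaves, then the second of these leaves is present
  when the first is attached, childless and contained in \<open>B\<close>, so the first is placed below its depth.
\<close>

lemma attach_position_deeper:
  assumes "\<tau> \<in> wtrees m" "attachable k B Y \<tau>" "\<tau>' \<in> wtrees m" "attachable k B Y' \<tau>'" "Y' \<subseteq> B"
    and eq: "attach k B Y \<tau> = attach k B Y' \<tau>'"
    and ne: "position k B Y \<tau> \<noteq> position k B Y' \<tau>'"
  shows "length (position k B Y' \<tau>') < length (position k B Y \<tau>)"
proof -
  let ?v = "position k B Y \<tau>" and ?v' = "position k B Y' \<tau>'"
  have "\<tau> ?v' = Some (k, Y')"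
    using fun_cong[OF eq, of ?v'] ne by (simp add: attach_def)
  moreover have "\<tau> (?v' @ [s]) = None" for s
  proof (cases "?v' @ [s] = ?v")
    case True
    then show ?thesis using position_free[OF assms(1,2)] by simp
  next
    case False
    then show ?thesis
      using fun_cong[OF eq, of "?v' @ [s]"] attach_leaf[OF assms(3,4), of s] by (simp add: attach_def)
  qed
  ultimately have "eligible \<tau> k B Y ?v'" using assms(5) by (simp add: eligible_def)
  then show ?thesis using position_deeper assms by blast
qed

text \<open>
  Two different new leaves would each be strictly deeper than the other. So the new leaf is determined
  by the tree, and removing it recovers \<open>Y\<close> and the original tree.
\<close>

lemma attach_inject:
  assumes "\<tau> \<in> wtrees m" "attachable k B Y \<tau>" "Y \<subseteq> B"
    and "\<tau>' \<in> wtrees m" "attachable k B Y' \<tau>'" "Y' \<subseteq> B"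
    and eq: "attach k B Y \<tau> = attach k B Y' \<tau>'"
  shows "Y = Y' \<and> \<tau> = \<tau>'"
proof -
  have v: "position k B Y \<tau> = position k B Y' \<tau>'"
    using attach_position_deeper[of \<tau> m k B Y \<tau>' Y'] attach_position_deeper[of \<tau>' m k B Y' \<tau> Y] assms
    by force
  then have "Y = Y'" using fun_cong[OF eq, of "position k B Y \<tau>"] by (simp add: attach_def)
  moreover have "\<tau> q = \<tau>' q" for q
  proof (cases "q = position k B Y \<tau>")
    case True
    then show ?thesis using v position_free[OF assms(1,2)] position_free[OF assms(4,5)] by simp
  next
    case False
    then show ?thesis using v fun_cong[OF eq, of q] by (simp add: attach_def)
  qed
  ultimately show ?thesis by blast
qed

end

section \<open>Weights relative to a configuration\<close>

definition occurrences :: "'v wtree \<Rightarrow> (nat option list \<times> nat \<times> 'v) set" where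
  "occurrences \<tau> = (SIGMA q:dom \<tau>. snd (the (\<tau> q)))"

definition deepest :: "'v wtree \<Rightarrow> nat option list \<Rightarrow> nat \<Rightarrow> bool" where
  "deepest \<tau> q i \<longleftrightarrow> (\<forall>q' l. \<tau> q' = Some l \<longrightarrow> involves (snd l) i \<longrightarrow> length q' \<le> length q)"

text \<open>
  The function \<open>r\<close> rates the elements at their earliest use, that is, at the deepest vertex that involves
  their variable, and \<open>p\<close> all later uses. For \<open>r = matches X\<close> this is the weight relative to the
  configuration \<open>X\<close>.
\<close>

definition weight :: "(nat \<Rightarrow> 'v event \<Rightarrow> real) \<Rightarrow> (nat \<times> 'v \<Rightarrow> real) \<Rightarrow> (nat \<times> 'v \<Rightarrow> real) \<Rightarrow> 'v wtree \<Rightarrow> real" where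
  "weight Q p r \<tau> = (\<Prod>q\<in>dom \<tau>. case_prod Q (the (\<tau> q))) *
     (\<Prod>(q, x)\<in>occurrences \<tau>. if deepest \<tau> q (fst x) then r x else p x)"

definition matches :: "'v config \<Rightarrow> nat \<times> 'v \<Rightarrow> real" where
  "matches X x = of_bool (X (fst x) = snd x)"

context bad_events
begin

lemma labelsD:
  assumes "(k, Y) \<in> labels"
  shows "finite Y" "inj_on fst Y" "Y \<noteq> {}" "Y \<subseteq> elements n F" "k \<in> {1..K}" "Y \<in> atomic n F"
proof -
  show "Y \<subseteq> elements n F" "inj_on fst Y" "Y \<noteq> {}" "k \<in> {1..K}" "Y \<in> atomic n F"
    using assms by (auto simp: labels_def atomic_def)
  have "finite (elements n F)" using finite_F by (auto simp: elements_def)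
  with \<open>Y \<subseteq> elements n F\<close> show "finite Y" by (rule finite_subset)
qed

lemma occurrences_iff: "(q, x) \<in> occurrences \<tau> \<longleftrightarrow> (\<exists>k Y. \<tau> q = Some (k, Y) \<and> x \<in> Y)"
  by (force simp: occurrences_def)

lemma finite_occurrences: "\<tau> \<in> wtrees m \<Longrightarrow> finite (occurrences \<tau>)"
  unfolding occurrences_def using finite_dom_wtrees labelsD(1) wtreesD(2)
  by (intro finite_SigmaI) (metis domD option.sel prod.collapse)+

lemma deepest_unique:
  assumes \<tau>: "\<tau> \<in> wtrees m"
    and "(q, x) \<in> occurrences \<tau>" "deepest \<tau> q (fst x)"
    and "(q', x') \<in> occurrences \<tau>" "deepest \<tau> q' (fst x')" "fst x = fst x'"
  shows "q = q' \<and> x = x'"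
proof -
  obtain k Y k' Y' where q: "\<tau> q = Some (k, Y)" "x \<in> Y" and q': "\<tau> q' = Some (k', Y')" "x' \<in> Y'"
    using assms by (auto simp: occurrences_iff)
  have i: "involves Y (fst x)" "involves Y' (fst x)"
    using imageI[OF q(2), of fst] imageI[OF q'(2), of fst] assms(6) by (simp_all add: involves_iff)
  have "length q' \<le> length q" "length q \<le> length q'"
    using assms(3,5)[unfolded deepest_def, rule_format] q(1) q'(1) i assms(6) by (metis snd_conv)+
  then have "q = q'"
    using wtreesD(4)[OF \<tau> q(1) q'(1)] i by (auto simp: related_iff)
  moreover have "inj_on fst Y" using labelsD(2) wtreesD(2)[OF \<tau> q(1)] by blast
  ultimately show ?thesis using q q' assms(6) by (auto dest: inj_onD)
qed

lemma weight_nonneg: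
  assumes \<tau>: "\<tau> \<in> wtrees m" and Q: "\<And>k Y. (k, Y) \<in> labels \<Longrightarrow> 0 \<le> Q k Y"
    and "\<And>x. x \<in> elements n F \<Longrightarrow> 0 \<le> p x" "\<And>x. x \<in> elements n F \<Longrightarrow> 0 \<le> r x"
  shows "0 \<le> weight Q p r \<tau>"
proof -
  have "0 \<le> case_prod Q (the (\<tau> q))" if "q \<in> dom \<tau>" for q
    using that wtreesD(2)[OF \<tau>] Q by fastforce
  moreover have "x \<in> elements n F" if "(q, x) \<in> occurrences \<tau>" for q x
    using that wtreesD(2)[OF \<tau>] labelsD(4) by (fastforce simp: occurrences_iff)
  ultimately show ?thesis
    unfolding weight_def using assms(3,4) by (intro mult_nonneg_nonneg prod_nonneg) auto
qed

lemma weight_cong: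
  assumes "\<And>q k Y x. \<tau> q = Some (k, Y) \<Longrightarrow> x \<in> Y \<Longrightarrow> r x = r' x"
  shows "weight Q p r \<tau> = weight Q p r' \<tau>"
proof -
  have "(\<Prod>(q, x)\<in>occurrences \<tau>. if deepest \<tau> q (fst x) then r x else p x) =
      (\<Prod>(q, x)\<in>occurrences \<tau>. if deepest \<tau> q (fst x) then r' x else p x)"
    using assms by (intro prod.cong) (auto simp: occurrences_iff)
  then show ?thesis by (simp add: weight_def)
qed

text \<open>
  A tree that rejects \<open>Y\<close> involves no variable of \<open>Y\<close>, so resampling \<open>Y\<close> leaves its weight unchanged.
\<close>

lemma weight_not_attachable:
  assumes "\<not> attachable k B Y \<tau>"
  shows "weight Q p (\<lambda>x. if fst x \<in> fst ` Y then p x else r x) \<tau> = weight Q p r \<tau>"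
proof (rule weight_cong)
  fix q l Z x assume q: "\<tau> q = Some (l, Z)" "x \<in> Z"
  then have "\<not> related Y Z" using assms by (auto simp: attachable_def eligible_def)
  moreover have "fst x \<in> fst ` Z" using q(2) by (rule imageI)
  ultimately have "fst x \<notin> fst ` Y" unfolding related_iff involves_iff by blast
  then show "(if fst x \<in> fst ` Y then p x else r x) = r x" by simp
qed

text \<open>
  The new leaf is the earliest use of all its variables, so it is rated by \<open>r\<close>, whereas the uses that
  were the earliest ones before now refer to values drawn by \<open>p\<close>.
\<close>

lemma weight_attach:
  assumes \<tau>: "\<tau> \<in> wtrees m" "attachable k B Y \<tau>"
    and B: "B \<in> Bs k" "k \<in> {1..K}" "Y \<subseteq> B" "Y \<noteq> {}"
  shows "weight Q p r (attach k B Y \<tau>) =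
    Q k Y * (\<Prod>x\<in>Y. r x) * weight Q p (\<lambda>x. if fst x \<in> fst ` Y then p x else r x) \<tau>"
proof -
  let ?v = "position k B Y \<tau>" and ?\<tau> = "attach k B Y \<tau>"
  have v: "?v \<notin> dom \<tau>" using position_free[OF \<tau>] by blast
  have Y: "finite Y" using attach_wtrees[OF \<tau> B] labelsD(1) wtreesD(2)
    by (metis attach_def fun_upd_same)
  have dom: "dom ?\<tau> = insert ?v (dom \<tau>)" by (auto simp: attach_def)
  have "(\<Prod>q\<in>dom ?\<tau>. case_prod Q (the (?\<tau> q))) =
      Q k Y * (\<Prod>q\<in>dom \<tau>. case_prod Q (the (?\<tau> q)))"
    unfolding dom using v finite_dom_wtrees[OF \<tau>(1)] by (simp add: attach_def)
  also have "(\<Prod>q\<in>dom \<tau>. case_prod Q (the (?\<tau> q))) = (\<Prod>q\<in>dom \<tau>. case_prod Q (the (\<tau> q)))"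
    using v by (intro prod.cong) (auto simp: attach_def)
  finally have Qs: "(\<Prod>q\<in>dom ?\<tau>. case_prod Q (the (?\<tau> q))) =
      Q k Y * (\<Prod>q\<in>dom \<tau>. case_prod Q (the (\<tau> q)))" .

  have occ: "occurrences ?\<tau> = Pair ?v ` Y \<union> occurrences \<tau>"
    using v by (auto simp: occurrences_iff attach_def split: if_splits)
  have "length q < length ?v" if "\<tau> q = Some l" "involves (snd l) i" "involves Y i" for q l i
    by (rule position_related_deeper[OF \<tau> that(1)]) (use that in \<open>auto simp: related_iff\<close>)
  then have deep_v: "deepest ?\<tau> ?v (fst x)" if "x \<in> Y" for x
    using that by (fastforce simp: deepest_def attach_def involves_iff)
  have deep: "deepest ?\<tau> q (fst x) \<longleftrightarrow> deepest \<tau> q (fst x) \<and> fst x \<notin> fst ` Y"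
    if qx: "(q, x) \<in> occurrences \<tau>" for q x
  proof -
    obtain l Z where q: "\<tau> q = Some (l, Z)" "x \<in> Z" using qx by (auto simp: occurrences_iff)
    show ?thesis
    proof (cases "fst x \<in> fst ` Y")
      case True
      moreover have "fst x \<in> fst ` Z" using q(2) by (rule imageI)
      ultimately have "related Y Z" unfolding related_iff involves_iff by blast
      then have "length q < length ?v"
        using position_related_deeper[OF \<tau> q(1)] by simp
      moreover have "?\<tau> ?v = Some (k, Y)" by (simp add: attach_def)
      moreover have "involves Y (fst x)" using True by (simp add: involves_iff)
      ultimately have "\<not> deepest ?\<tau> q (fst x)"
        unfolding deepest_def by (metis not_le snd_conv)
      then show ?thesis using True by blast
    next
      case False
      have "?\<tau> q' = Some l' \<and> involves (snd l') (fst x) \<longleftrightarrow> \<tau> q' = Some l' \<and> involves (snd l') (fst x)" for q' l'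
        using False v by (auto simp: attach_def involves_iff)
      then have "deepest ?\<tau> q (fst x) \<longleftrightarrow> deepest \<tau> q (fst x)" unfolding deepest_def by blast
      then show ?thesis using False by blast
    qed
  qed
  have "(\<Prod>(q, x)\<in>occurrences ?\<tau>. if deepest ?\<tau> q (fst x) then r x else p x)
      = (\<Prod>(q, x)\<in>Pair ?v ` Y. if deepest ?\<tau> q (fst x) then r x else p x) *
        (\<Prod>(q, x)\<in>occurrences \<tau>. if deepest ?\<tau> q (fst x) then r x else p x)"
    unfolding occ using Y v finite_occurrences[OF \<tau>(1)]
    by (intro prod.union_disjoint) (auto simp: occurrences_iff)
  also have "(\<Prod>(q, x)\<in>Pair ?v ` Y. if deepest ?\<tau> q (fst x) then r x else p x) = (\<Prod>x\<in>Y. r x)"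
    using deep_v by (subst prod.reindex) (auto simp: inj_on_def intro!: prod.cong)
  also have "(\<Prod>(q, x)\<in>occurrences \<tau>. if deepest ?\<tau> q (fst x) then r x else p x) =
      (\<Prod>(q, x)\<in>occurrences \<tau>. if deepest \<tau> q (fst x)
         then (if fst x \<in> fst ` Y then p x else r x) else p x)"
    using deep by (intro prod.cong) auto
  finally show ?thesis unfolding weight_def Qs by (simp add: mult_ac)
qed

lemma weight_product:
  assumes \<tau>: "\<tau> \<in> wtrees m"
  shows "weight Q p p \<tau> = tree_weight (\<lambda>(k, Y). Q k Y * (\<Prod>x\<in>Y. p x)) \<tau>"
proof -
  have "finite (snd (the (\<tau> q)))" if "q \<in> dom \<tau>" for q
    using that wtreesD(2)[OF \<tau>] labelsD(1) by fastforce
  then have "(\<Prod>(q, x)\<in>occurrences \<tau>. p x) = (\<Prod>q\<in>dom \<tau>. \<Prod>x\<in>snd (the (\<tau> q)). p x)"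
    unfolding occurrences_def using finite_dom_wtrees[OF \<tau>] by (subst prod.Sigma) auto
  moreover have "(\<Prod>(q, x)\<in>occurrences \<tau>. if deepest \<tau> q (fst x) then p x else p x) =
      (\<Prod>(q, x)\<in>occurrences \<tau>. p x)" by (simp only: if_cancel)
  ultimately show ?thesis
    unfolding weight_def tree_weight_def
    by (simp only: prod.distrib[symmetric]) (simp add: case_prod_unfold)
qed

text \<open>
  Every variable has only one earliest use (\<open>deepest_unique\<close>). So the weight, as a function of the fresh
  values, is a product of functions of the single variables, and independence lets the expectation
  pass to the factors.
\<close>

lemma expected_weight:
  assumes \<tau>: "\<tau> \<in> wtrees m" and "finite A"
    and Q: "\<And>k Y. (k, Y) \<in> labels \<Longrightarrow> 0 \<le> Q k Y"
    and p: "\<And>x. x \<in> elements n F \<Longrightarrow> 0 \<le> p x"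
    and V: "\<And>i j. i \<in> A \<Longrightarrow> (i, j) \<in> elements n F \<Longrightarrow> pmf (V i) j = p (i, j)"
  shows "(\<integral>\<^sup>+ X'. ennreal (weight Q p (matches (override_on X X' A)) \<tau>) \<partial>Pi_pmf A d V) =
    ennreal (weight Q p (\<lambda>x. if fst x \<in> A then p x else matches X x) \<tau>)"
proof -
  define fresh where "fresh = {z \<in> occurrences \<tau>. deepest \<tau> (fst z) (fst (snd z)) \<and> fst (snd z) \<in> A}"
  \<comment> \<open>the part of the weight that does not depend on the fresh values\<close>
  define c where "c = (\<Prod>q\<in>dom \<tau>. case_prod Q (the (\<tau> q))) *
    (\<Prod>(q, x)\<in>occurrences \<tau> - fresh. if deepest \<tau> q (fst x) then matches X x else p x)"
  define part where "part i = {z \<in> fresh. fst (snd z) = i}" for i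
  have fin: "finite (occurrences \<tau>)" "finite fresh" "fresh \<subseteq> occurrences \<tau>"
    using finite_occurrences[OF \<tau>] by (auto simp: fresh_def)
  have elem: "x \<in> elements n F" if "(q, x) \<in> occurrences \<tau>" for q x
    using that wtreesD(2)[OF \<tau>] labelsD(4) by (fastforce simp: occurrences_iff)
  have split: "weight Q p r \<tau> = c * (\<Prod>i\<in>A. \<Prod>z\<in>part i. r (snd z))"
    if r: "\<And>x. fst x \<notin> A \<Longrightarrow> r x = matches X x" for r
  proof -
    have "(\<Prod>(q, x)\<in>occurrences \<tau>. if deepest \<tau> q (fst x) then r x else p x)
       = (\<Prod>(q, x)\<in>occurrences \<tau> - fresh. if deepest \<tau> q (fst x) then r x else p x) *
         (\<Prod>(q, x)\<in>fresh. if deepest \<tau> q (fst x) then r x else p x)"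
      using fin by (intro prod.subset_diff)
    also have "(\<Prod>(q, x)\<in>occurrences \<tau> - fresh. if deepest \<tau> q (fst x) then r x else p x) =
        (\<Prod>(q, x)\<in>occurrences \<tau> - fresh. if deepest \<tau> q (fst x) then matches X x else p x)"
      using r by (intro prod.cong) (auto simp: fresh_def)
    also have "(\<Prod>(q, x)\<in>fresh. if deepest \<tau> q (fst x) then r x else p x) = (\<Prod>z\<in>fresh. r (snd z))"
      by (intro prod.cong) (auto simp: fresh_def)
    also have "\<dots> = (\<Prod>i\<in>A. \<Prod>z\<in>part i. r (snd z))"
      unfolding part_def using fin \<open>finite A\<close> by (intro prod.group[symmetric]) (auto simp: fresh_def)
    finally show ?thesis by (simp add: weight_def c_def mult_ac)
  qed
  have part_cases: "part i = {} \<or> (\<exists>z. part i = {z} \<and> fst (snd z) = i \<and> snd z \<in> elements n F)" for i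
  proof (cases "part i = {}")
    case False
    then obtain z where z: "z \<in> part i" by blast
    have "z' = z" if "z' \<in> part i" for z'
      using that z deepest_unique[OF \<tau>, of "fst z" "snd z" "fst z'" "snd z'"]
      by (auto simp: part_def fresh_def prod_eq_iff)
    with z have "part i = {z}" by blast
    moreover have "snd z \<in> elements n F" "fst (snd z) = i"
      using z elem[of "fst z" "snd z"] by (auto simp: part_def fresh_def)
    ultimately show ?thesis by blast
  qed simp
  have c: "0 \<le> c"
  proof -
    have "0 \<le> case_prod Q (the (\<tau> q))" if "q \<in> dom \<tau>" for q
      using that wtreesD(2)[OF \<tau>] Q by fastforce
    then show ?thesis unfolding c_def using elem p
      by (intro mult_nonneg_nonneg prod_nonneg) (auto simp: matches_def)
  qed
  have marginal: "(\<integral>\<^sup>+ v. ennreal (\<Prod>z\<in>part i. of_bool (v = snd (snd z))) \<partial>V i) = ennreal (\<Prod>z\<in>part i. p (snd z))"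
    if "i \<in> A" for i
    using part_cases[of i]
  proof
    assume "\<exists>z. part i = {z} \<and> fst (snd z) = i \<and> snd z \<in> elements n F"
    then obtain q j where z: "part i = {(q, i, j)}" "(i, j) \<in> elements n F" by auto
    have "(\<integral>\<^sup>+ v. ennreal (of_bool (v = j)) \<partial>V i) = (\<integral>\<^sup>+ v. indicator {j} v \<partial>V i)"
      by (intro nn_integral_cong) (simp add: indicator_def)
    also have "\<dots> = ennreal (p (i, j))"
      using V[OF that z(2)] by (simp add: emeasure_pmf_single)
    finally show ?thesis by (simp add: z)
  qed (simp add: measure_pmf.emeasure_space_1[simplified])
  have "(\<integral>\<^sup>+ X'. ennreal (weight Q p (matches (override_on X X' A)) \<tau>) \<partial>Pi_pmf A d V) =
    (\<integral>\<^sup>+ X'. ennreal c * (\<Prod>i\<in>A. ennreal (\<Prod>z\<in>part i. of_bool (X' i = snd (snd z)))) \<partial>Pi_pmf A d V)"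
  proof (rule nn_integral_cong)
    fix X' :: "nat \<Rightarrow> 'v"
    have "weight Q p (matches (override_on X X' A)) \<tau> =
        c * (\<Prod>i\<in>A. \<Prod>z\<in>part i. matches (override_on X X' A) (snd z))"
      by (rule split) (simp add: matches_def)
    also have "(\<Prod>i\<in>A. \<Prod>z\<in>part i. matches (override_on X X' A) (snd z)) =
        (\<Prod>i\<in>A. \<Prod>z\<in>part i. of_bool (X' i = snd (snd z)))"
      by (rule prod.cong, rule refl, rule prod.cong) (auto simp: matches_def part_def fresh_def)
    finally show "ennreal (weight Q p (matches (override_on X X' A)) \<tau>) =
        ennreal c * (\<Prod>i\<in>A. ennreal (\<Prod>z\<in>part i. of_bool (X' i = snd (snd z))))"
      using c by (simp add: ennreal_mult prod_nonneg prod_ennreal)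
  qed
  also have "\<dots> = ennreal c * (\<Prod>i\<in>A. ennreal (\<Prod>z\<in>part i. p (snd z)))"
  proof -
    have "(\<integral>\<^sup>+ X'. (\<Prod>i\<in>A. ennreal (\<Prod>z\<in>part i. of_bool (X' i = snd (snd z)))) \<partial>Pi_pmf A d V)
        = (\<Prod>i\<in>A. \<integral>\<^sup>+ v. ennreal (\<Prod>z\<in>part i. of_bool (v = snd (snd z))) \<partial>V i)"
      by (rule nn_integral_prod_Pi_pmf[OF \<open>finite A\<close>])
    also have "\<dots> = (\<Prod>i\<in>A. ennreal (\<Prod>z\<in>part i. p (snd z)))"
      by (rule prod.cong[OF refl marginal])
    finally show ?thesis by (subst nn_integral_cmult) simp_all
  qed
  also have "\<dots> = ennreal (c * (\<Prod>i\<in>A. \<Prod>z\<in>part i. p (snd z)))"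
  proof -
    have "0 \<le> (\<Prod>z\<in>part i. p (snd z))" for i
      using elem p by (intro prod_nonneg) (auto simp: part_def fresh_def)
    then show ?thesis using c by (simp add: ennreal_mult prod_nonneg prod_ennreal)
  qed
  also have "c * (\<Prod>i\<in>A. \<Prod>z\<in>part i. p (snd z)) =
      c * (\<Prod>i\<in>A. \<Prod>z\<in>part i. if fst (snd z) \<in> A then p (snd z) else matches X (snd z))"
    by (simp add: part_def fresh_def)
  also have "\<dots> = weight Q p (\<lambda>x. if fst x \<in> A then p x else matches X x) \<tau>"
    by (rule split[symmetric]) simp
  finally show ?thesis .
qed

end

section \<open>The effect of one resampling\<close>

lemma weight_empty: "weight Q p r Map.empty = 1"
  by (simp add: weight_def occurrences_def)

context bad_events
begin

lemma empty_wtrees: "Map.empty \<in> wtrees m"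
  by (simp add: wtrees_def)

text \<open>
  The left-hand side is the expected weight of all trees, including the empty one, after the
  resampling of a random subset \<open>Y\<close> of the true event \<open>B\<close>. Pairs \<open>(Y, \<tau>)\<close> with \<open>\<tau>\<close> accepting \<open>Y\<close> are
  charged to the tree obtained by attachment, injectively; the other pairs are charged to \<open>\<tau>\<close> itself,
  which is not the result of attaching a subset of \<open>B\<close>. The empty tree accepts everything and is thereby saved on
  the right-hand side: this is the decrease by one.
\<close>

lemma weight_drift:
  assumes k: "k \<in> {1..K}" and B: "B \<in> Bs k" "holds B X"
    and Q: "\<And>k Y. (k, Y) \<in> labels \<Longrightarrow> 0 \<le> Q k Y"
    and p: "\<And>x. x \<in> elements n F \<Longrightarrow> 0 \<le> p x"
    and hit: "1 \<le> (\<Sum>Y | Y \<subseteq> B \<and> Y \<noteq> {}. Q k Y)" (is "1 \<le> ?s")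
  shows "(\<Sum>Y | Y \<subseteq> B \<and> Y \<noteq> {}. Q k Y / ?s *
      (\<Sum>\<tau>\<in>wtrees m. weight Q p (\<lambda>x. if fst x \<in> fst ` Y then p x else matches X x) \<tau>))
    \<le> (\<Sum>\<tau>\<in>wtrees (Suc m) - {Map.empty}. weight Q p (matches X) \<tau>)"
proof -
  define U where "U = {Y. Y \<subseteq> B \<and> Y \<noteq> {}}"
  define w where "w = weight Q p (matches X)"
  define avg where "avg Y = weight Q p (\<lambda>x. if fst x \<in> fst ` Y then p x else matches X x)"
    for Y :: "'v event"
  \<comment> \<open>accepting pairs, rejecting pairs, and the trees that occur in the latter\<close>
  define A where "A = {(Y, \<tau>) \<in> U \<times> wtrees m. attachable k B Y \<tau>}"
  define N where "N = {(Y, \<tau>) \<in> U \<times> wtrees m. \<not> attachable k B Y \<tau>}"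
  define W where "W = {\<tau> \<in> wtrees m. \<exists>Y\<in>U. \<not> attachable k B Y \<tau>}"
  let ?I = "(\<lambda>(Y, \<tau>). attach k B Y \<tau>) ` A"
  have B_label: "(k, B) \<in> labels" using k B(1) Bs_atomic by (auto simp: labels_def)
  have U_label: "(k, Y) \<in> labels" if "Y \<in> U" for Y
    using B_label atomic_subset[of B n F Y] that by (auto simp: labels_def U_def)
  have "finite U" using labelsD(1)[OF B_label] by (auto simp: U_def)
  then have fin: "finite A" "finite N" "finite W" "finite (U \<times> wtrees m)"
    using finite_wtrees
    by (auto simp: A_def N_def W_def intro: finite_subset[of _ "U \<times> wtrees m"])
  have Q_U: "0 \<le> Q k Y" if "Y \<in> U" for Y using Q U_label[OF that] by blast
  have w: "0 \<le> w \<tau>" if "\<tau> \<in> wtrees m'" for \<tau> m'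
    unfolding w_def by (rule weight_nonneg[OF that Q p]) (auto simp: matches_def)
  have Aw: "Q k Y / ?s * avg Y \<tau> \<le> w (attach k B Y \<tau>)" if "(Y, \<tau>) \<in> A" for Y \<tau>
  proof -
    have Y: "\<tau> \<in> wtrees m" "attachable k B Y \<tau>" "Y \<subseteq> B" "Y \<noteq> {}"
      using that by (auto simp: A_def U_def)
    have "(\<Prod>x\<in>Y. matches X x) = 1"
      using B(2) Y(3) by (intro prod.neutral) (fastforce simp: matches_def holds_def)
    then have "w (attach k B Y \<tau>) = Q k Y * avg Y \<tau>"
      using weight_attach[OF Y(1,2) B(1) k Y(3,4), of Q p "matches X"] by (simp add: w_def avg_def)
    moreover have "0 \<le> w (attach k B Y \<tau>)"
      using w[OF attach_wtrees[OF Y(1,2) B(1) k Y(3,4)]] .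
    ultimately show ?thesis
      using hit mult_left_mono[OF hit, of "Q k Y * avg Y \<tau>"] by (simp add: divide_le_eq)
  qed
  have "(\<Sum>Y\<in>U. Q k Y / ?s * (\<Sum>\<tau>\<in>wtrees m. avg Y \<tau>))
      = (\<Sum>(Y, \<tau>)\<in>U \<times> wtrees m. Q k Y / ?s * avg Y \<tau>)"
    by (simp add: sum_distrib_left sum.cartesian_product)
  also have "U \<times> wtrees m = A \<union> N" by (auto simp: A_def N_def)
  also have "(\<Sum>(Y, \<tau>)\<in>A \<union> N. Q k Y / ?s * avg Y \<tau>)
      = (\<Sum>(Y, \<tau>)\<in>A. Q k Y / ?s * avg Y \<tau>) + (\<Sum>(Y, \<tau>)\<in>N. Q k Y / ?s * avg Y \<tau>)"
    using fin by (intro sum.union_disjoint) (auto simp: A_def N_def)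
  also have "\<dots> \<le> sum w ?I + sum w W"
  proof (rule add_mono)
    have "(\<Sum>(Y, \<tau>)\<in>A. Q k Y / ?s * avg Y \<tau>) \<le> (\<Sum>(Y, \<tau>)\<in>A. w (attach k B Y \<tau>))"
      using Aw by (intro sum_mono) auto
    also have "\<dots> = sum w ?I"
    proof -
      have "inj_on (\<lambda>(Y, \<tau>). attach k B Y \<tau>) A"
      proof (rule inj_onI, clarify)
        fix Y \<tau> Y' \<tau>'
        assume "(Y, \<tau>) \<in> A" "(Y', \<tau>') \<in> A" "attach k B Y \<tau> = attach k B Y' \<tau>'"
        then show "Y = Y' \<and> \<tau> = \<tau>'"
          using attach_inject[of \<tau> m k B Y \<tau>' Y'] by (simp add: A_def U_def)
      qed
      then show ?thesis by (simp add: sum.reindex case_prod_unfold)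
    qed
    finally show "(\<Sum>(Y, \<tau>)\<in>A. Q k Y / ?s * avg Y \<tau>) \<le> sum w ?I" .
    have "(\<Sum>(Y, \<tau>)\<in>N. Q k Y / ?s * avg Y \<tau>) = (\<Sum>(Y, \<tau>)\<in>N. Q k Y / ?s * w \<tau>)"
      by (intro sum.cong) (auto simp: N_def avg_def w_def weight_not_attachable)
    also have "\<dots> \<le> (\<Sum>(Y, \<tau>)\<in>U \<times> W. Q k Y / ?s * w \<tau>)"
      using fin \<open>finite U\<close> w Q_U hit
      by (intro sum_mono2) (auto simp: N_def W_def intro!: mult_nonneg_nonneg divide_nonneg_nonneg)
    also have "\<dots> = (\<Sum>Y\<in>U. Q k Y / ?s) * sum w W"
      by (simp add: sum_product sum.cartesian_product)
    also have "(\<Sum>Y\<in>U. Q k Y / ?s) = 1"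
      using hit by (simp add: U_def flip: sum_divide_distrib)
    finally show "(\<Sum>(Y, \<tau>)\<in>N. Q k Y / ?s * avg Y \<tau>) \<le> sum w W" by simp
  qed
  also have "\<dots> = sum w (?I \<union> W)"
  proof (rule sum.union_disjoint[symmetric])
    have "attachable k B Y' (attach k B Y \<tau>)" if "(Y, \<tau>) \<in> A" for Y \<tau> Y'
      using that attach_imp_attachable by (auto simp: A_def U_def)
    then show "?I \<inter> W = {}" by (auto simp: W_def)
  qed (use fin in auto)
  also have "\<dots> \<le> sum w (wtrees (Suc m) - {Map.empty})"
  proof (rule sum_mono2)
    have "attach k B Y \<tau> \<in> wtrees (Suc m) - {Map.empty}" if "(Y, \<tau>) \<in> A" for Y \<tau>
      using that attach_wtrees[OF _ _ B(1) k, of \<tau> m Y] attach_nonempty[of k B Y \<tau>]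
      by (simp add: A_def U_def)
    then have "?I \<subseteq> wtrees (Suc m) - {Map.empty}" by (intro image_subsetI) (simp add: case_prod_unfold)
    moreover have "Map.empty \<notin> W" by (auto simp: W_def attachable_def)
    moreover have "W \<subseteq> wtrees (Suc m)" using wtrees_mono by (auto simp: W_def)
    ultimately show "?I \<union> W \<subseteq> wtrees (Suc m) - {Map.empty}" by blast
  qed (use finite_wtrees w in auto)
  finally show ?thesis by (simp only: U_def avg_def w_def)
qed

end

section \<open>The convergence criterion\<close>

locale pra_criterion = bad_events n K F Bs
  for n K :: nat and F :: "nat \<Rightarrow> 'v set" and Bs :: "nat \<Rightarrow> 'v event set" +
  fixes Q :: "nat \<Rightarrow> 'v event \<Rightarrow> real" and lam :: "nat \<times> 'v \<Rightarrow> real"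
  assumes hitting: "\<And>k. k \<in> {1..K} \<Longrightarrow> fractional_hitting_set n F (Bs k) (Q k)"
    and lam_nonneg: "\<And>x. x \<in> elements n F \<Longrightarrow> 0 \<le> lam x"
    and S_less_1: "\<And>k. k \<in> {1..K} \<Longrightarrow> S n F (Bs k) (Q k) lam < 1"
    and var_sum_ge: "\<And>i. i \<in> {1..n} \<Longrightarrow> var_sum F lam i \<ge>
      1 + (\<Sum>k=1..K. G n F i (Q k) lam / (1 - S n F (Bs k) (Q k) lam))"
begin

definition prob :: "nat \<times> 'v \<Rightarrow> real" where
  "prob x = lam x / var_sum F lam (fst x)"

text \<open>
  The bound, in the end, for the total weight of the trees with root label \<open>l\<close>.
\<close>

definition majorant :: "'v label \<Rightarrow> real" where
  "majorant l = Q (fst l) (snd l) * monomial lam (snd l) / (1 - S n F (Bs (fst l)) (Q (fst l)) lam)"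

lemma Q_nonneg: "(k, Y) \<in> labels \<Longrightarrow> 0 \<le> Q k Y"
  using hitting[of k] by (auto simp: labels_def fractional_hitting_set_def)

lemma monomial_nonneg: "Y \<in> atomic n F \<Longrightarrow> 0 \<le> monomial lam Y"
  unfolding monomial_def using lam_nonneg by (intro prod_nonneg) (auto simp: atomic_def)

lemma majorant_nonneg: "l \<in> labels \<Longrightarrow> 0 \<le> majorant l"
  unfolding majorant_def using Q_nonneg[of "fst l" "snd l"] monomial_nonneg[of "snd l"] S_less_1[of "fst l"]
  by (auto simp: labels_def intro!: divide_nonneg_pos mult_nonneg_nonneg)

lemma sum_majorant_var:
  assumes "i \<in> {1..n}"
  shows "1 + (\<Sum>l | l \<in> labels \<and> involves (snd l) i. majorant l) \<le> var_sum F lam i"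
proof -
  have "{l \<in> labels. involves (snd l) i} = {1..K} \<times> {Y. Y \<in> atomic n F \<and> involves Y i}"
    by (auto simp: labels_def)
  then have "(\<Sum>l | l \<in> labels \<and> involves (snd l) i. majorant l)
      = (\<Sum>k=1..K. \<Sum>Y | Y \<in> atomic n F \<and> involves Y i. majorant (k, Y))"
    by (simp add: sum.cartesian_product)
  also have "\<dots> = (\<Sum>k=1..K. G n F i (Q k) lam / (1 - S n F (Bs k) (Q k) lam))"
    by (simp add: majorant_def G_def sum_divide_distrib)
  finally show ?thesis using var_sum_ge[OF assms] by simp
qed

lemma var_sum_ge_1: "i \<in> {1..n} \<Longrightarrow> 1 \<le> var_sum F lam i"
  using sum_majorant_var[of i] sum_nonneg[of "{l \<in> labels. involves (snd l) i}" majorant]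
    majorant_nonneg by fastforce

lemma prob_nonneg: "x \<in> elements n F \<Longrightarrow> 0 \<le> prob x"
  unfolding prob_def using lam_nonneg[of x] var_sum_ge_1[of "fst x"]
  by (auto simp: elements_def intro!: divide_nonneg_nonneg)

lemma S_bound:
  assumes "Y \<in> atomic n F" "Q k Y > 0" "k \<in> {1..K}"
  shows "(\<Sum>Z | Z \<in> atomic n F \<and> bowtie (Bs k) Z Y. Q k Z * monomial lam Z) \<le> S n F (Bs k) (Q k) lam"
proof -
  let ?D = "{Y \<in> atomic n F. Q k Y > 0}"
  have "finite ?D" using finite_atomic[of n F, OF finite_F] by simp
  moreover have "?D \<noteq> {}" using assms by blast
  ultimately show ?thesis unfolding S_def Let_def using assms by (auto intro!: Max_ge)
qed

text \<open>
  A child in the slot \<open>None\<close> belongs to the same family as its parent, so the denominators agree and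
  the geometric series \<open>1 + S / (1 - S) = 1 / (1 - S)\<close> appears. For \<open>Q k Y = 0\<close> the maximum
  in \<open>S\<close> says nothing about \<open>Y\<close>.
\<close>

lemma sum_majorant_bowtie:
  assumes "(k, Y) \<in> labels" "Q k Y > 0"
  shows "1 + (\<Sum>l\<in>child_labels (k, Y) None. majorant l) \<le> 1 / (1 - S n F (Bs k) (Q k) lam)"
proof -
  let ?S = "S n F (Bs k) (Q k) lam"
  have k: "k \<in> {1..K}" "Y \<in> atomic n F" using assms(1) by (auto simp: labels_def)
  have "child_labels (k, Y) None = Pair k ` {Z. Z \<in> atomic n F \<and> bowtie (Bs k) Z Y}"
    using k by (auto simp: child_labels_def labels_def)
  then have "(\<Sum>l\<in>child_labels (k, Y) None. majorant l)
      = (\<Sum>Z | Z \<in> atomic n F \<and> bowtie (Bs k) Z Y. Q k Z * monomial lam Z) / (1 - ?S)"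
    by (simp add: sum.reindex inj_on_def majorant_def sum_divide_distrib)
  also have "\<dots> \<le> ?S / (1 - ?S)"
    using S_bound[OF k(2) assms(2) k(1)] S_less_1[OF k(1)] by (intro divide_right_mono) auto
  finally show ?thesis using S_less_1[OF k(1)] by (simp add: field_simps)
qed

lemma vertex_weight_nonneg:
  assumes "l \<in> labels"
  shows "0 \<le> (case l of (k, Y) \<Rightarrow> Q k Y * (\<Prod>x\<in>Y. prob x))"
proof -
  obtain k Y where l: "l = (k, Y)" by (cases l)
  have "0 \<le> (\<Prod>x\<in>Y. prob x)"
    using assms labelsD(4)[of k Y] prob_nonneg by (intro prod_nonneg) (auto simp: l)
  then show ?thesis using Q_nonneg[of k Y] assms by (simp add: l)
qed

text \<open>
  The slots of the variables of \<open>Y\<close> contribute at most \<open>var_sum F lam i\<close> each, which cancels the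
  denominators of the probabilities; the slot \<open>None\<close> contributes at most \<open>1 / (1 - S)\<close>.
\<close>

lemma majorant_branching:
  assumes "l \<in> labels"
  shows "(case l of (k, Y) \<Rightarrow> Q k Y * (\<Prod>x\<in>Y. prob x)) *
    (\<Prod>s\<in>slots. 1 + (\<Sum>l'\<in>child_labels l s. majorant l')) \<le> majorant l"
proof -
  obtain k Y where l: "l = (k, Y)" by (cases l)
  note kY = labelsD[OF assms[unfolded l]]
  let ?S = "S n F (Bs k) (Q k) lam"
  let ?c = "\<lambda>s. 1 + (\<Sum>l'\<in>child_labels l s. majorant l')"
  show ?thesis
  proof (cases "Q k Y = 0")
    case True
    then show ?thesis by (simp add: l majorant_def)
  next
    case False
    then have Q: "Q k Y > 0" using Q_nonneg assms l by (metis order_le_less)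
    have pos: "0 < var_sum F lam i" if "i \<in> fst ` Y" for i
      using that kY(4) var_sum_ge_1[of i] by (auto simp: elements_def)
    have c_nonneg: "0 \<le> ?c s" for s
      using majorant_nonneg by (intro add_nonneg_nonneg sum_nonneg) (auto simp: child_labels_def)
    have "(\<Prod>s\<in>slots. ?c s) = ?c None * (\<Prod>i\<in>{1..n}. ?c (Some i))"
      unfolding slots_def by (subst prod.insert) (auto simp: prod.reindex)
    also have "(\<Prod>i\<in>{1..n}. ?c (Some i)) = (\<Prod>i\<in>fst ` Y. ?c (Some i))"
    proof (rule prod.mono_neutral_right)
      show "fst ` Y \<subseteq> {1..n}" using kY(4) by (auto simp: elements_def)
      show "\<forall>i\<in>{1..n} - fst ` Y. ?c (Some i) = 1"
        by (auto simp: l child_labels_def involves_iff)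
    qed simp
    also have "?c None * (\<Prod>i\<in>fst ` Y. ?c (Some i)) \<le> 1 / (1 - ?S) * (\<Prod>i\<in>fst ` Y. var_sum F lam i)"
    proof (intro mult_mono prod_mono conjI)
      show "?c None \<le> 1 / (1 - ?S)"
        using sum_majorant_bowtie Q assms l by blast
      show "?c (Some i) \<le> var_sum F lam i" if "i \<in> fst ` Y" for i
      proof -
        have "child_labels l (Some i) = {l \<in> labels. involves (snd l) i}"
          using that by (auto simp: l child_labels_def involves_iff)
        then show ?thesis using sum_majorant_var[of i] that kY(4) by (auto simp: elements_def)
      qed
      show "0 \<le> 1 / (1 - ?S)" using S_less_1[OF kY(5)] by simp
    qed (use c_nonneg in \<open>auto intro!: prod_nonneg\<close>)
    finally have "(case l of (k, Y) \<Rightarrow> Q k Y * (\<Prod>x\<in>Y. prob x)) * (\<Prod>s\<in>slots. ?c s)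
        \<le> Q k Y * (\<Prod>x\<in>Y. prob x) * (1 / (1 - ?S) * (\<Prod>i\<in>fst ` Y. var_sum F lam i))"
      using vertex_weight_nonneg[OF assms] unfolding l prod.case by (rule mult_left_mono)
    also have "\<dots> = Q k Y * ((\<Prod>x\<in>Y. prob x) * (\<Prod>x\<in>Y. var_sum F lam (fst x))) / (1 - ?S)"
      using kY(2) by (simp add: prod.reindex)
    also have "(\<Prod>x\<in>Y. prob x) * (\<Prod>x\<in>Y. var_sum F lam (fst x)) = (\<Prod>x\<in>Y. lam x)"
      unfolding prod.distrib[symmetric] using pos by (intro prod.cong) (force simp: prob_def)+
    finally show ?thesis by (simp add: l majorant_def monomial_def)
  qed
qed

lemma sum_weight_le:
  "(\<Sum>\<tau>\<in>wtrees m - {Map.empty}. weight Q prob prob \<tau>) \<le> (\<Sum>i=1..n. var_sum F lam i - 1)"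
proof -
  let ?w = "\<lambda>(k, Y). Q k Y * (\<Prod>x\<in>Y. prob x)"
  let ?T = "trees slots child_labels labels m"
  have w: "0 \<le> ?w l" if "l \<in> labels" for l
    using vertex_weight_nonneg[OF that] .
  have closed: "child_labels l s \<subseteq> labels" for l s by (auto simp: child_labels_def)
  have ran: "l \<in> labels" if "\<tau> \<in> ?T" "\<tau> q = Some l" for \<tau> q l
    using trees_label_in[OF that(1) subset_refl closed that(2)] .
  have fin: "finite ?T" using finite_trees finite_slots finite_labels finite_child_labels by blast
  have nonneg: "0 \<le> tree_weight ?w \<tau>" if "\<tau> \<in> ?T" for \<tau>
    unfolding tree_weight_def using ran[OF that] w by (intro prod_nonneg ballI) auto
  have "1 + (\<Sum>\<tau>\<in>wtrees m - {Map.empty}. weight Q prob prob \<tau>) = (\<Sum>\<tau>\<in>wtrees m. weight Q prob prob \<tau>)"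
    using empty_wtrees finite_wtrees by (subst sum.remove[of _ Map.empty]) (auto simp: weight_empty)
  also have "\<dots> = (\<Sum>\<tau>\<in>wtrees m. tree_weight ?w \<tau>)"
    by (intro sum.cong refl weight_product)
  also have "\<dots> \<le> (\<Sum>\<tau>\<in>?T. tree_weight ?w \<tau>)"
    using fin wtrees_subset_trees nonneg by (intro sum_mono2) auto
  also have "\<dots> \<le> 1 + (\<Sum>l\<in>labels. majorant l)"
  proof -
    have "0 \<le> (\<Sum>\<tau>\<in>?T. tree_weight ?w \<tau>) \<and> (\<Sum>\<tau>\<in>?T. tree_weight ?w \<tau>) \<le> 1 + (\<Sum>l\<in>labels. majorant l)"
      by (rule sum_tree_weight_le[where L = labels])
        (use w majorant_nonneg majorant_branching finite_slots finite_child_labels finite_labels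
          in \<open>auto simp: child_labels_def\<close>)
    then show ?thesis by blast
  qed
  \<comment> \<open>every label involves at least one variable\<close>
  also have "(\<Sum>l\<in>labels. majorant l) \<le> (\<Sum>i=1..n. \<Sum>l | l \<in> labels \<and> involves (snd l) i. majorant l)"
  proof -
    have "(\<Sum>l\<in>labels. majorant l) \<le> (\<Sum>l\<in>labels. \<Sum>i=1..n. if involves (snd l) i then majorant l else 0)"
    proof (rule sum_mono)
      fix l assume l: "l \<in> labels"
      then obtain i j where "(i, j) \<in> snd l" using labelsD(3)[of "fst l" "snd l"] by auto
      then have i: "i \<in> {1..n}" "involves (snd l) i"
        using labelsD(4)[of "fst l" "snd l"] l by (auto simp: elements_def involves_def)
      then have "majorant l = (if involves (snd l) i then majorant l else 0)" by simp
      also have "\<dots> \<le> (\<Sum>i=1..n. if involves (snd l) i then majorant l else 0)"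
        using i(1) majorant_nonneg[OF l] by (intro member_le_sum) auto
      finally show "majorant l \<le> (\<Sum>i=1..n. if involves (snd l) i then majorant l else 0)" .
    qed
    also have "\<dots> = (\<Sum>i=1..n. \<Sum>l\<in>labels. if involves (snd l) i then majorant l else 0)"
      by (rule sum.swap)
    also have "\<dots> = (\<Sum>i=1..n. \<Sum>l | l \<in> labels \<and> involves (snd l) i. majorant l)"
      using finite_labels by (simp add: sum.inter_filter)
    finally show ?thesis .
  qed
  also have "\<dots> \<le> (\<Sum>i=1..n. var_sum F lam i - 1)"
    using sum_majorant_var by (intro sum_mono) fastforce
  finally show ?thesis by simp
qed

end

section \<open>Loops with a decreasing potential\<close>

text \<open>
  The loop cut off after \<open>m\<close> iterations.
\<close>

primrec run_steps :: "('s \<Rightarrow> bool) \<Rightarrow> ('s \<Rightarrow> 's pmf) \<Rightarrow> nat \<Rightarrow> 's \<Rightarrow> 's pmf" where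
  "run_steps b c 0 s = return_pmf s"
| "run_steps b c (Suc m) s = bind_pmf (if b s then c s else return_pmf s) (run_steps b c m)"

lemma run_steps_terminated: "\<not> b s \<Longrightarrow> run_steps b c m s = return_pmf s"
  by (induction m) (auto simp: bind_return_pmf)

lemma prob_while_run_steps: "prob_while b c s = bind_pmf (run_steps b c m s) (prob_while b c)"
proof (induction m arbitrary: s)
  case (Suc m)
  have "prob_while b c s = bind_pmf (if b s then c s else return_pmf s) (prob_while b c)"
    by (cases "b s") (simp_all only: prob_while.simps[of b c s] if_True if_False bind_return_pmf bind_spmf_of_pmf)
  also have "\<dots> = bind_pmf (if b s then c s else return_pmf s)
      (\<lambda>s'. bind_pmf (run_steps b c m s') (prob_while b c))"
    by (intro bind_pmf_cong refl Suc.IH)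
  finally show ?case
    by (simp add: bind_assoc_pmf)
qed (simp add: bind_return_pmf)

lemma run_steps_length:
  assumes "\<And>s s'. b s \<Longrightarrow> s' \<in> set_pmf (c s) \<Longrightarrow> len s' = Suc (len s)"
  shows "s' \<in> set_pmf (run_steps b c m s) \<Longrightarrow> b s' \<Longrightarrow> len s' = len s + m"
proof (induction m arbitrary: s)
  case (Suc m)
  show ?case
  proof (cases "b s")
    case True
    then obtain t where "t \<in> set_pmf (c s)" "s' \<in> set_pmf (run_steps b c m t)"
      using Suc.prems by auto
    then show ?thesis using assms[OF True, of t] Suc.IH[of t] Suc.prems(2) by simp
  next
    case False
    then have "s' = s" using Suc.prems(1) by (simp add: bind_return_pmf run_steps_terminated)
    with False Suc.prems(2) show ?thesis by simp
  qed
qed simp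

text \<open>
  If the loop still runs, one iteration increases \<open>len\<close> by one and lowers the potential by at least
  one in expectation, so \<open>len + \<Psi>\<close> does not increase on average. The index of \<open>\<Psi>\<close> counts the iterations
  that remain.
\<close>

lemma run_steps_expected_length:
  fixes \<Psi> :: "nat \<Rightarrow> 's \<Rightarrow> ennreal" and len :: "'s \<Rightarrow> nat"
  assumes len: "\<And>s s'. b s \<Longrightarrow> s' \<in> set_pmf (c s) \<Longrightarrow> len s' = Suc (len s)"
    and drift: "\<And>m s. b s \<Longrightarrow> 1 + (\<integral>\<^sup>+ s'. \<Psi> m s' \<partial>c s) \<le> \<Psi> (Suc m) s"
  shows "(\<integral>\<^sup>+ s'. of_nat (len s') \<partial>run_steps b c m s) \<le> of_nat (len s) + \<Psi> m s"
proof (induction m arbitrary: s)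
  case (Suc m)
  show ?case
  proof (cases "b s")
    case True
    have "(\<integral>\<^sup>+ s'. of_nat (len s') \<partial>run_steps b c (Suc m) s)
        \<le> (\<integral>\<^sup>+ t. of_nat (len t) + \<Psi> m t \<partial>c s)"
      using True Suc.IH by (simp add: nn_integral_mono)
    also have "\<dots> = (\<integral>\<^sup>+ t. of_nat (Suc (len s)) + \<Psi> m t \<partial>c s)"
      using len[OF True] by (intro nn_integral_cong_AE AE_pmfI) auto
    also have "\<dots> = of_nat (len s) + (1 + (\<integral>\<^sup>+ t. \<Psi> m t \<partial>c s))"
      by (simp add: nn_integral_add measure_pmf.emeasure_space_1[simplified] ac_simps)
    also have "\<dots> \<le> of_nat (len s) + \<Psi> (Suc m) s"
      using drift[OF True] by (rule add_left_mono)
    finally show ?thesis .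
  next
    case False
    then have "run_steps b c (Suc m) s = return_pmf s" by (rule run_steps_terminated)
    then show ?thesis by simp
  qed
qed simp

text \<open>
  Truncate \<open>len\<close> at \<open>m\<close> and let non-termination count as \<open>m\<close>. Since \<open>len\<close> equals \<open>m\<close> in every state in
  which the loop is still running after \<open>m\<close> iterations, the truncated cost of the whole run is at most
  the expected length after \<open>m\<close> iterations, hence at most \<open>\<beta>\<close>. The truncated costs increase to \<open>len\<close>,
  and to \<open>\<infinity>\<close> on non-terminating runs, so monotone convergence yields the bound and, as \<open>\<beta>\<close> is finite,
  termination with probability one.
\<close>

lemma prob_while_expected_length:
  fixes \<Psi> :: "nat \<Rightarrow> 's \<Rightarrow> ennreal" and len :: "'s \<Rightarrow> nat" and D :: "'s pmf"
  assumes len: "\<And>s s'. b s \<Longrightarrow> s' \<in> set_pmf (c s) \<Longrightarrow> len s' = Suc (len s)"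
    and drift: "\<And>m s. b s \<Longrightarrow> 1 + (\<integral>\<^sup>+ s'. \<Psi> m s' \<partial>c s) \<le> \<Psi> (Suc m) s"
    and start: "\<And>s. s \<in> set_pmf D \<Longrightarrow> len s = 0"
    and bound: "\<And>m. (\<integral>\<^sup>+ s. \<Psi> m s \<partial>D) \<le> \<beta>" and "\<beta> < \<infinity>"
  defines "P \<equiv> bind_spmf (spmf_of_pmf D) (prob_while b c)"
  shows "lossless_spmf P \<and> (\<integral>\<^sup>+ r. (case r of None \<Rightarrow> \<infinity> | Some s \<Rightarrow> of_nat (len s)) \<partial>P) \<le> \<beta>"
proof -
  define g :: "nat \<Rightarrow> 's option \<Rightarrow> ennreal" where
    "g m r = of_nat (case r of None \<Rightarrow> m | Some s \<Rightarrow> min m (len s))" for m r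
  have g_le: "(\<integral>\<^sup>+ r. g m r \<partial>P) \<le> \<beta>" for m
  proof -
    define R where "R = bind_pmf D (run_steps b c m)"
    have P: "P = bind_pmf R (prob_while b c)"
      unfolding P_def R_def bind_spmf_of_pmf bind_assoc_pmf
      by (intro bind_pmf_cong prob_while_run_steps refl)
    have "(\<integral>\<^sup>+ r. g m r \<partial>prob_while b c s) \<le> of_nat (len s)" if "s \<in> set_pmf R" for s
    proof (cases "b s")
      case True
      then have "len s = m"
        using that run_steps_length[of b c len s m, OF len] start by (auto simp: R_def)
      then have "(\<integral>\<^sup>+ r. g m r \<partial>prob_while b c s) \<le> (\<integral>\<^sup>+ r. of_nat (len s) \<partial>prob_while b c s)"
        by (intro nn_integral_mono) (auto simp: g_def split: option.splits)
      then show ?thesis by (simp add: measure_pmf.emeasure_space_1[simplified])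
    next
      case False
      then have "prob_while b c s = return_pmf (Some s)" by (subst prob_while.simps) simp
      then show ?thesis by (simp add: g_def)
    qed
    then have "(\<integral>\<^sup>+ r. g m r \<partial>P) \<le> (\<integral>\<^sup>+ s. of_nat (len s) \<partial>R)"
      unfolding P nn_integral_bind_pmf by (intro nn_integral_mono_AE AE_pmfI)
    also have "\<dots> = (\<integral>\<^sup>+ s. (\<integral>\<^sup>+ t. of_nat (len t) \<partial>run_steps b c m s) \<partial>D)"
      by (simp add: R_def)
    also have "\<dots> \<le> (\<integral>\<^sup>+ s. of_nat (len s) + \<Psi> m s \<partial>D)"
      by (intro nn_integral_mono run_steps_expected_length[where b = b and c = c and len = len and \<Psi> = \<Psi>] len drift)
    also have "\<dots> = (\<integral>\<^sup>+ s. \<Psi> m s \<partial>D)"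
      using start by (intro nn_integral_cong_AE AE_pmfI) simp
    finally show ?thesis using bound[of m] by (rule order_trans)
  qed
  have "(SUP m. g m r) = (case r of None \<Rightarrow> \<infinity> | Some s \<Rightarrow> of_nat (len s))" for r
  proof (cases r)
    case None
    then show ?thesis by (simp add: g_def ennreal_SUP_of_nat_eq_top)
  next
    case (Some s)
    have "(SUP m. g m r) = of_nat (len s)"
    proof (rule antisym)
      show "(SUP m. g m r) \<le> of_nat (len s)"
        by (rule SUP_least) (simp add: g_def Some)
      show "of_nat (len s) \<le> (SUP m. g m r)"
        by (rule SUP_upper2[of "len s"]) (simp_all add: g_def Some)
    qed
    with Some show ?thesis by simp
  qed
  then have "(\<integral>\<^sup>+ r. (case r of None \<Rightarrow> \<infinity> | Some s \<Rightarrow> of_nat (len s)) \<partial>P)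
      = (\<integral>\<^sup>+ r. (SUP m. g m r) \<partial>P)" by simp
  also have "\<dots> = (SUP m. \<integral>\<^sup>+ r. g m r \<partial>P)"
    by (intro nn_integral_monotone_convergence_SUP)
      (auto simp: incseq_def le_fun_def g_def split: option.splits)
  also have "\<dots> \<le> \<beta>" by (rule SUP_least) (rule g_le)
  finally have le: "(\<integral>\<^sup>+ r. (case r of None \<Rightarrow> \<infinity> | Some s \<Rightarrow> of_nat (len s)) \<partial>P) \<le> \<beta>" .
  then have "(\<integral>\<^sup>+ r. (case r of None \<Rightarrow> \<infinity> | Some s \<Rightarrow> of_nat (len s)) \<partial>P) \<noteq> \<infinity>"
    using \<open>\<beta> < \<infinity>\<close> by (auto simp: top_unique)
  then have "AE r in P. (case r of None \<Rightarrow> \<infinity> :: ennreal | Some s \<Rightarrow> of_nat (len s)) \<noteq> \<infinity>"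
    by (intro nn_integral_noteq_infinite) auto
  then have "None \<notin> set_pmf P" by (auto simp: AE_measure_pmf_iff)
  with le show ?thesis by (simp add: lossless_iff_set_pmf_None)
qed

section \<open>Analysis of the algorithm\<close>

context pra_criterion
begin

text \<open>
  Trees of height at most \<open>m\<close> account for the first \<open>m\<close> iterations, and keep all sums finite.
\<close>

definition potential :: "nat \<Rightarrow> 'v config \<Rightarrow> real" where
  "potential m X = (\<Sum>\<tau>\<in>wtrees m - {Map.empty}. weight Q prob (matches X) \<tau>)"

abbreviation marginals :: "nat \<Rightarrow> 'v \<Rightarrow> real" where
  "marginals \<equiv> \<lambda>i j. lam (i, j) / var_sum F lam i"

lemma pmf_var_prob:
  assumes "(i, j) \<in> elements n F"
  shows "pmf (var_pmf F marginals i) j = prob (i, j)"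
proof -
  have i: "i \<in> {1..n}" "j \<in> F i" using assms by (auto simp: elements_def)
  have "pmf (var_pmf F marginals i) j = (if j \<in> F i then marginals i j else 0)"
  proof (rule pmf_var_pmf)
    show "finite (F i)" using finite_F i by blast
    show "0 \<le> marginals i j'" if "j' \<in> F i" for j'
      using prob_nonneg[of "(i, j')"] that i by (simp add: prob_def elements_def)
    show "(\<Sum>j'\<in>F i. marginals i j') = 1"
      using var_sum_ge_1[OF i(1)] by (simp add: var_sum_def flip: sum_divide_distrib)
  qed
  then show ?thesis using i by (simp add: prob_def)
qed

lemma ennreal_sum_weight:
  assumes "T \<subseteq> wtrees m" "\<And>x. x \<in> elements n F \<Longrightarrow> 0 \<le> r x"
  shows "(\<Sum>\<tau>\<in>T. ennreal (weight Q prob r \<tau>)) = ennreal (\<Sum>\<tau>\<in>T. weight Q prob r \<tau>)"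
  using assms by (intro sum_ennreal weight_nonneg[of _ m] Q_nonneg prob_nonneg) auto

lemma expected_potential:
  assumes "finite A"
  shows "(\<integral>\<^sup>+ X'. ennreal (potential m (override_on X X' A)) \<partial>Pi_pmf A undefined (var_pmf F marginals)) =
    ennreal (\<Sum>\<tau>\<in>wtrees m - {Map.empty}. weight Q prob (\<lambda>x. if fst x \<in> A then prob x else matches X x) \<tau>)"
proof -
  let ?T = "wtrees m - {Map.empty}"
  have "(\<integral>\<^sup>+ X'. ennreal (potential m (override_on X X' A)) \<partial>Pi_pmf A undefined (var_pmf F marginals)) =
    (\<integral>\<^sup>+ X'. (\<Sum>\<tau>\<in>?T. ennreal (weight Q prob (matches (override_on X X' A)) \<tau>))
      \<partial>Pi_pmf A undefined (var_pmf F marginals))"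
    unfolding potential_def
    by (intro nn_integral_cong ennreal_sum_weight[symmetric, of _ m]) (auto simp: matches_def)
  also have "\<dots> = (\<Sum>\<tau>\<in>?T. \<integral>\<^sup>+ X'. ennreal (weight Q prob (matches (override_on X X' A)) \<tau>)
      \<partial>Pi_pmf A undefined (var_pmf F marginals))"
    by (rule nn_integral_sum) simp
  also have "\<dots> = (\<Sum>\<tau>\<in>?T. ennreal (weight Q prob (\<lambda>x. if fst x \<in> A then prob x else matches X x) \<tau>))"
    by (intro sum.cong refl expected_weight[of _ m] assms Q_nonneg prob_nonneg pmf_var_prob) auto
  also have "\<dots> = ennreal (\<Sum>\<tau>\<in>?T. weight Q prob (\<lambda>x. if fst x \<in> A then prob x else matches X x) \<tau>)"
    by (intro ennreal_sum_weight[of _ m]) (auto simp: matches_def prob_nonneg)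
  finally show ?thesis .
qed

lemma initial_potential:
  "(\<integral>\<^sup>+ X. ennreal (potential m X) \<partial>Pi_pmf {1..n} undefined (var_pmf F marginals))
    \<le> ennreal (\<Sum>i=1..n. var_sum F lam i - 1)"
proof -
  have in_range: "fst x \<in> {1..n}" if "\<tau> \<in> wtrees m" "\<tau> q = Some (k, Y)" "x \<in> Y" for \<tau> q k Y x
    using labelsD(4)[OF wtreesD(2)[OF that(1,2)]] that(3) by (auto simp: elements_def)
  \<comment> \<open>the initial draw is a resampling of all variables, starting from an arbitrary configuration\<close>
  have "potential m X = potential m (override_on undefined X {1..n})" for X
    unfolding potential_def
    by (intro sum.cong refl weight_cong) (auto simp: matches_def dest!: in_range)
  then have "(\<integral>\<^sup>+ X. ennreal (potential m X) \<partial>Pi_pmf {1..n} undefined (var_pmf F marginals)) =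
      (\<integral>\<^sup>+ X. ennreal (potential m (override_on undefined X {1..n})) \<partial>Pi_pmf {1..n} undefined (var_pmf F marginals))"
    by (intro nn_integral_cong) simp
  also have "\<dots> = ennreal (\<Sum>\<tau>\<in>wtrees m - {Map.empty}.
      weight Q prob (\<lambda>x. if fst x \<in> {1..n} then prob x else matches undefined x) \<tau>)"
    by (rule expected_potential) simp
  also have "(\<Sum>\<tau>\<in>wtrees m - {Map.empty}.
      weight Q prob (\<lambda>x. if fst x \<in> {1..n} then prob x else matches undefined x) \<tau>) =
      (\<Sum>\<tau>\<in>wtrees m - {Map.empty}. weight Q prob prob \<tau>)"
    by (intro sum.cong refl weight_cong) (auto dest!: in_range)
  also have "ennreal \<dots> \<le> ennreal (\<Sum>i=1..n. var_sum F lam i - 1)"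
    by (intro ennreal_leI sum_weight_le)
  finally show ?thesis .
qed

lemma resampling_drift:
  assumes kB: "(k, B) \<in> true_bad_events K Bs X"
  shows "1 + (\<integral>\<^sup>+ Y. (\<integral>\<^sup>+ X'. ennreal (potential m (override_on X X' (fst ` Y)))
      \<partial>Pi_pmf (fst ` Y) undefined (var_pmf F marginals)) \<partial>subset_pmf (Q k) B) \<le> ennreal (potential (Suc m) X)"
proof -
  let ?s = "\<Sum>Y | Y \<subseteq> B \<and> Y \<noteq> {}. Q k Y"
  let ?r = "\<lambda>Y x. if fst x \<in> fst ` Y then prob x else matches X x"
  let ?g = "\<lambda>Y. \<integral>\<^sup>+ X'. ennreal (potential m (override_on X X' (fst ` Y)))
      \<partial>Pi_pmf (fst ` Y) undefined (var_pmf F marginals)"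
  let ?avg = "\<lambda>Y. \<Sum>\<tau>\<in>wtrees m. weight Q prob (?r Y) \<tau>"
  define U where "U = {Y. Y \<subseteq> B \<and> Y \<noteq> {}}"
  have k: "k \<in> {1..K}" and B: "B \<in> Bs k" "holds B X"
    using kB by (auto simp: true_bad_events_def)
  have B_label: "(k, B) \<in> labels" using k B(1) Bs_atomic by (auto simp: labels_def)
  have U_label: "(k, Y) \<in> labels" if "Y \<in> U" for Y
    using B_label atomic_subset[of B n F Y] that by (auto simp: labels_def U_def)
  have finU: "finite U" using labelsD(1)[OF B_label] by (auto simp: U_def)
  have hit: "1 \<le> ?s" using hitting[OF k] B(1) by (auto simp: fractional_hitting_set_def)
  have pmf: "pmf (subset_pmf (Q k) B) Y = (if Y \<in> U then Q k Y / ?s else 0)" for Y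
    unfolding U_def
    using pmf_subset_pmf[OF _ hitting[OF k] Bs_atomic[OF k] B(1), of Y] finite_F by simp
  have r: "0 \<le> ?r Y x" if "x \<in> elements n F" for Y x
    using prob_nonneg[OF that] by (simp add: matches_def)
  have avg_nonneg: "0 \<le> ?avg Y" for Y
    using weight_nonneg[OF _ Q_nonneg prob_nonneg r] by (intro sum_nonneg) auto
  have g: "1 + ?g Y = ennreal (?avg Y)" if "Y \<in> U" for Y
  proof -
    let ?rest = "\<Sum>\<tau>\<in>wtrees m - {Map.empty}. weight Q prob (?r Y) \<tau>"
    have "?g Y = ennreal ?rest"
      using labelsD(1)[OF U_label[OF that]] by (intro expected_potential) simp
    moreover have "?avg Y = 1 + ?rest"
      using empty_wtrees finite_wtrees by (subst sum.remove[of _ Map.empty]) (auto simp: weight_empty)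
    moreover have "0 \<le> ?rest"
      using weight_nonneg[OF _ Q_nonneg prob_nonneg r] by (intro sum_nonneg) auto
    ultimately show ?thesis by (simp add: ennreal_plus)
  qed
  have "1 + (\<integral>\<^sup>+ Y. ?g Y \<partial>subset_pmf (Q k) B) = (\<integral>\<^sup>+ Y. 1 + ?g Y \<partial>subset_pmf (Q k) B)"
    by (simp add: nn_integral_add measure_pmf.emeasure_space_1[simplified])
  also have "\<dots> = (\<Sum>Y\<in>U. (1 + ?g Y) * pmf (subset_pmf (Q k) B) Y)"
    using finU by (intro nn_integral_measure_pmf_support) (auto simp: set_pmf_iff pmf)
  also have "\<dots> = (\<Sum>Y\<in>U. ennreal (Q k Y / ?s * ?avg Y))"
  proof (rule sum.cong)
    fix Y assume Y: "Y \<in> U"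
    have "0 \<le> Q k Y / ?s" using Q_nonneg[OF U_label[OF Y]] hit by simp
    then show "(1 + ?g Y) * pmf (subset_pmf (Q k) B) Y = ennreal (Q k Y / ?s * ?avg Y)"
      using Y avg_nonneg[of Y] by (simp only: g pmf if_True ennreal_mult' mult.commute)
  qed simp
  also have "\<dots> = ennreal (\<Sum>Y\<in>U. Q k Y / ?s * ?avg Y)"
    using Q_nonneg U_label hit avg_nonneg
    by (intro sum_ennreal mult_nonneg_nonneg divide_nonneg_nonneg) auto
  also have "\<dots> \<le> ennreal (potential (Suc m) X)"
    unfolding potential_def U_def
    by (intro ennreal_leI weight_drift[where Q = Q and p = prob] k B Q_nonneg prob_nonneg hit)
  finally show ?thesis .
qed

lemma pra_step_drift:
  assumes sel: "valid_rule K Bs sel" and bad: "true_bad_events K Bs X \<noteq> {}"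
  shows "1 + (\<integral>\<^sup>+ s. ennreal (potential m (fst s)) \<partial>pra_step F Q marginals sel (X, h))
    \<le> ennreal (potential (Suc m) X)"
proof -
  let ?g = "\<lambda>(k, B). \<integral>\<^sup>+ Y. (\<integral>\<^sup>+ X'. ennreal (potential m (override_on X X' (fst ` Y)))
      \<partial>Pi_pmf (fst ` Y) undefined (var_pmf F marginals)) \<partial>subset_pmf (Q k) B"
  have "(\<integral>\<^sup>+ s. ennreal (potential m (fst s)) \<partial>pra_step F Q marginals sel (X, h)) = (\<integral>\<^sup>+ kB. ?g kB \<partial>sel (X, h))"
    by (simp add: pra_step_def case_prod_unfold)
  then have "1 + (\<integral>\<^sup>+ s. ennreal (potential m (fst s)) \<partial>pra_step F Q marginals sel (X, h)) =
      (\<integral>\<^sup>+ kB. 1 + ?g kB \<partial>sel (X, h))"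
    by (simp add: nn_integral_add measure_pmf.emeasure_space_1[simplified])
  also have "\<dots> \<le> (\<integral>\<^sup>+ kB. ennreal (potential (Suc m) X) \<partial>sel (X, h))"
  proof (intro nn_integral_mono_AE AE_pmfI)
    fix kB assume "kB \<in> set_pmf (sel (X, h))"
    then have "kB \<in> true_bad_events K Bs X"
      using sel bad unfolding valid_rule_def by blast
    then show "1 + ?g kB \<le> ennreal (potential (Suc m) X)"
      using resampling_drift[of "fst kB" "snd kB" X m] by (simp add: case_prod_unfold)
  qed
  also have "\<dots> = ennreal (potential (Suc m) X)"
    by (simp add: measure_pmf.emeasure_space_1[simplified])
  finally show ?thesis .
qed

lemma pra_multi_bound:
  assumes "valid_rule K Bs sel"
  shows "lossless_spmf (pra_multi n F K Bs Q marginals sel) \<and>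
    expected_resamplings (pra_multi n F K Bs Q marginals sel) \<le> ennreal (\<Sum>i=1..n. (var_sum F lam i - 1))"
proof -
  let ?b = "\<lambda>(X, h). true_bad_events K Bs X \<noteq> {}" and ?c = "pra_step F Q marginals sel"
  let ?D = "map_pmf (\<lambda>X. (X, [])) (Pi_pmf {1..n} undefined (var_pmf F marginals)) :: 'v state pmf"
  have pra: "pra_multi n F K Bs Q marginals sel = bind_spmf (spmf_of_pmf ?D) (prob_while ?b ?c)"
    by (simp add: pra_multi_def bind_map_pmf)
  have cases: "(case r of None \<Rightarrow> \<infinity> | Some (X, h) \<Rightarrow> of_nat (length h)) =
      (case r of None \<Rightarrow> \<infinity> :: ennreal | Some s \<Rightarrow> of_nat (length (snd s)))" for r :: "'v state option"
    by (simp split: option.split)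
  show ?thesis
    unfolding expected_resamplings_def cases pra
  proof (rule prob_while_expected_length[where \<Psi> = "\<lambda>m s. ennreal (potential m (fst s))"])
    show "length (snd s') = Suc (length (snd s))" if "?b s" "s' \<in> set_pmf (?c s)" for s s'
      using that by (auto simp: pra_step_def)
    show "1 + (\<integral>\<^sup>+ s'. ennreal (potential m (fst s')) \<partial>?c s) \<le> ennreal (potential (Suc m) (fst s))"
      if "?b s" for m s
      using pra_step_drift[OF assms, of "fst s" "snd s" m] that by (simp add: case_prod_unfold)
    show "(\<integral>\<^sup>+ s. ennreal (potential m (fst s)) \<partial>?D) \<le> ennreal (\<Sum>i=1..n. var_sum F lam i - 1)" for m
      using initial_potential by simp
  qed auto
qed

end

theorem theorem3p8:
  fixes n K :: nat
    and F :: "nat \<Rightarrow> 'v set"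
    and Bs :: "nat \<Rightarrow> 'v event set"
    and Q :: "nat \<Rightarrow> 'v event \<Rightarrow> real"
    and lam :: "nat \<times> 'v \<Rightarrow> real"
    and sel :: "'v rule"
  assumes "\<forall>i\<in>{1..n}. finite (F i)"
    and "\<forall>k\<in>{1..K}. Bs k \<subseteq> atomic n F"
    and "\<forall>k\<in>{1..K}. fractional_hitting_set n F (Bs k) (Q k)"
    and "\<forall>x\<in>elements n F. 0 \<le> lam x"
    and "\<forall>k\<in>{1..K}. S n F (Bs k) (Q k) lam < 1"
    and "\<forall>i\<in>{1..n}. var_sum F lam i \<ge>
           1 + (\<Sum>k=1..K. G n F i (Q k) lam / (1 - S n F (Bs k) (Q k) lam))"
    and "valid_rule K Bs sel"
  defines "p \<equiv> \<lambda>i j. lam (i, j) / var_sum F lam i"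
  shows "lossless_spmf (pra_multi n F K Bs Q p sel) \<and>
    expected_resamplings (pra_multi n F K Bs Q p sel) \<le> ennreal (\<Sum>i=1..n. (var_sum F lam i - 1))"
proof -
  interpret pra_criterion n K F Bs Q lam
    by unfold_locales (use assms in blast)+
  show ?thesis unfolding p_def using assms(7) by (rule pra_multi_bound)
qed

end
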